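(* Let $\mathcal K$ satisfy the kernel assumption, let $P>0$ be real, let $M\ge 1$, $N\ge M$ and $N_T\ge 1$ be integers, set $\Delta t=T/N_T$, $\Delta x=P/N$, and let $u^P_0$ satisfy the initial-data assumption (all as in the context). Assume that $$\Delta t < \frac{1}{10\, L^P \|\mathcal{K}\|_{L^1 (\mathbb{R})}}\,\min\left\{\frac{1}{\|u^P_0\|_{L^\infty(I_P)}\, e^{10 L^P T \|\mathcal{K}\|_{L^1(\mathbb{R})}} + 1},\, 1\right\}$$ and $$\frac{\Delta t}{\Delta x} < \frac{1}{10 \|\mathcal{K}\|_{L^1 (\mathbb{R})}} \min\left\{ \frac{1}{\|u^P_0\|_{L^\infty(I_P)}\, e^{10 L^P T \|\mathcal{K}\|_{L^1(\mathbb{R})}} + 1},\ \frac{1}{3 \|u^P_0\|_{L^\infty(I_P)}\, e^{10 L^P T \|\mathcal{K}\|_{L^1(\mathbb{R})}}} \right\}.$$ Then, for any $1\le n\le N_T$, the scheme described in the context admits a unique solution $u^{P,n}=(u^{P,n}_i)_{i\in\mathcal I_N}$ such that $$\max_{i\in\mathcal I_N}|u^{P,n}_i|\le \|u^P_0\|_{L^\infty(I_P)}\,e^{10L^PT\|\mathcal K\|_{L^1(\mathbb R)}},$$ and $\theta^{P,n}_{i+1/2}+L^P\ge 0$ for all $i\in\mathcal I_N$. Furthermore, this solution satisfies $$TV(u^{P,n}):=\sum_{i\in\mathcal I_N}|u^{P,n}_{i+1}-u^{P,n}_i|\le TV(u^P_0)\,e^{10L^PT\|\mathcal K\|_{L^1(\mathbb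 R)}},\qquad \forall\, 1\le n\le N_T.$$ Finally, there exists a constant $\zeta_0>0$, depending only on $T$ and $\|\mathcal K\|_{L^1(\mathbb R)}$, such that $$\sum_{i\in\mathcal I_N}\Delta x\,f\left(\theta^{P,n}_{i+1/2}+L^P\right)\le\sum_{i\in\mathcal I_N}\Delta x\,f\left(\theta^{P,0}_{i+1/2}+L^P\right)+\zeta_0\,TV(u^P_0),\qquad \forall\, 1\le n\le N_T.$$
   Context: $T>0$ is fixed. $I_P=\mathbb R/2P\mathbb Z$; functions on $I_P$ are identified with $2P$-periodic functions on $\mathbb R$. For $w,z\in L^1(I_P)$, $(w\ast z)(x)=\int_{I_P}w(x-y)z(y)\,dy$. For $I=\mathbb R$ or $I=I_P$, $L\log L(I)$ is the space of $g\in L^1_{\rm loc}(I)$ with $\int_I|g|\ln(e+|g|)\,dx<\infty$. Kernel assumption: $\mathcal K\in L^1(\mathbb R)$ is even, $\int_{\mathbb R}\mathcal K\,dx=0$ and its Fourier transform satisfies $\mathcal F(\mathcal K)(\xi)\le 0$ for all $\xi\ne 0$. The number $L^P$: $v_0\in L^\infty(\mathbb R)$ is a (continuous) nondecreasing function with $\partial_xv_0\in L^1(\mathbb R)\cap L\log L(\mathbb R)$, and $L^P=\frac{v_0(P)-v_0(-P)}{2P}$. Initial-data assumption: $u^P_0\in L^\infty(I_P)$ with $\partial_xu^P_0\in L^1(I_P)\cap L\log L(I_P)$ (so $u^P_0$ is taken continuous), and $x\in[-P,P)\mapsto u^P_0(x)+L^Px$ is nondecreasing. $TV(u^P_0)$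 denotes the total variation of $u^P_0$ on $I_P$. Regularized periodic kernel: $\mathcal K^P$ is the $2P$-periodic function equal to $\mathcal K$ on $[-P,P]$. For a positive integer $m$, $F_m(x)=\frac1m\sum_{\ell=0}^{m-1}\sum_{|k|\le\ell}e^{i\pi kx/P}$ is the Fejér kernel. Set $$\mathcal K^P_M(x)=\mathcal K^P(x)-\frac{2F_{2M}(x)}{P}\int_{|y|\ge P}|\mathcal K(y)|\,dy,\qquad \sigma^P_M=\frac1{2P}\,F_M\ast\mathcal K^P_M,$$ i.e. $\sigma^P_M$ is the Cesàro mean of order $M$ of the Fourier series of $\mathcal K^P_M$. Scheme: $\mathcal I_N=\mathbb Z/2N\mathbb Z$, $x_i=i\Delta x$ (modulo $2P$), $\sigma^P_{M,j}=\sigma^P_M(x_j)$. For a vector $v=(v_i)_{i\in\mathcal I_N}$, $\lambda^M_i[v]=\sum_{j\in\mathcal I_N}\Delta x\,\sigma^P_{M,j}\,v_{i-j}$, with $\lambda_i^M[v]_+=\frac12(|\lambda_i^M[v]|+\lambda_i^M[v])$ and $\lambda_i^M[v]_-=\frac12(|\lambda_i^M[v]|-\lambda_i^M[v])$. Set $u^{P,0}_i=u^P_0(x_i)$, $\theta^{P,n}_{i+1/2}=(u^{P,n}_{i+1}-u^{P,n}_i)/\Delta x$, and, given $u^{P,n}$, $0\le n\le N_T-1$, the vector $u^{P,n+1}$ is required to solve, for all $i\in\mathcal I_N$, $$\frac{u^{P,n+1}_i-u^{P,n}_i}{\Delta t}=\lambda^M_i[u^{P,n+1}]_+\,\theta^{P,n}_{i+1/2}-\lambda^M_i[u^{P,n+1}]_-\,\theta^{P,n}_{i-1/2}+L^P\lambda^M_i[u^{P,n+1}].$$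 The function $f:[0,\infty)\to[0,\infty)$ is $f(x)=x\ln x+\frac1e$ if $x\ge 1/e$ and $f(x)=0$ if $0\le x\le 1/e$. A fraction with zero denominator in the two step-size conditions is read as $+\infty$. *)

theory Defs
  imports "HOL-Probability.Probability"
begin

text \<open>
  Elements of an \<open>L\<^sup>p\<close> space are represented by Borel functions.  Functions on
  the torus \<open>I\<^sub>P\<close> are \<open>2P\<close>-periodic functions on the real line, with integrals, norms and
  variations taken over \<open>{-P..P}\<close>; likewise vectors indexed by \<open>\<int>/2N\<int>\<close> are
  \<open>2N\<close>-periodic functions on \<open>int\<close>.
\<close>

definition per :: "real \<Rightarrow> (real \<Rightarrow> real) \<Rightarrow> bool" where
  "per P f \<longleftrightarrow> (\<forall>x. f (x + 2 * P) = f x)"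

definition per_vec :: "nat \<Rightarrow> (int \<Rightarrow> real) \<Rightarrow> bool" where
  "per_vec N v \<longleftrightarrow> (\<forall>i. v (i + 2 * int N) = v i)"


definition Linf_esssup :: "real set \<Rightarrow> (real \<Rightarrow> real) \<Rightarrow> ereal" where
  "Linf_esssup S f = esssup (restrict_space lborel S) (\<lambda>x. ereal \<bar>f x\<bar>)"

definition in_Linf :: "real set \<Rightarrow> (real \<Rightarrow> real) \<Rightarrow> bool" where
  "in_Linf S f \<longleftrightarrow> f \<in> borel_measurable (restrict_space lborel S) \<and> Linf_esssup S f < \<infinity>"

definition Linf_norm :: "real set \<Rightarrow> (real \<Rightarrow> real) \<Rightarrow> real" where
  "Linf_norm S f = real_of_ereal (Linf_esssup S f)"

definition L1_norm :: "(real \<Rightarrow> real) \<Rightarrow> real" where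
  "L1_norm f = (LINT x|lborel. \<bar>f x\<bar>)"

definition in_LlogL :: "real set \<Rightarrow> (real \<Rightarrow> real) \<Rightarrow> bool" where
  "in_LlogL S g \<longleftrightarrow>
     (\<forall>a b. set_integrable lborel (S \<inter> {a..b}) g) \<and>
     set_integrable lborel S (\<lambda>x. \<bar>g x\<bar> * ln (exp 1 + \<bar>g x\<bar>))"

definition test_function :: "(real \<Rightarrow> real) \<Rightarrow> bool" where
  "test_function \<phi> \<longleftrightarrow>
     (\<forall>n x. (deriv ^^ n) \<phi> differentiable (at x)) \<and> (\<exists>R. \<forall>x. \<bar>x\<bar> > R \<longrightarrow> \<phi> x = 0)"

definition weak_deriv :: "(real \<Rightarrow> real) \<Rightarrow> (real \<Rightarrow> real) \<Rightarrow> bool" where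
  "weak_deriv u g \<longleftrightarrow>
     (\<forall>a b. set_integrable lborel {a..b} u \<and> set_integrable lborel {a..b} g) \<and>
     (\<forall>\<phi>. test_function \<phi> \<longrightarrow>
        (LINT x|lborel. u x * deriv \<phi> x) = - (LINT x|lborel. g x * \<phi> x))"

text \<open>
  Over \<open>{-P..P}\<close>, for a \<open>2P\<close>-periodic function, this is the variation on the torus.
  The supremum is only meaningful for functions of bounded variation; this covers
  \<open>initial_data\<close> below, where \<open>u\<close> is the difference of two monotone functions.
\<close>

definition total_variation :: "real \<Rightarrow> real \<Rightarrow> (real \<Rightarrow> real) \<Rightarrow> real" where
  "total_variation a b u =
     Sup {(\<Sum>k<n. \<bar>u (s (Suc k)) - u (s k)\<bar>) | n s.
            (\<forall>k\<le>n. s k \<in> {a..b}) \<and> (\<forall>k<n. s k \<le> s (Suc k))}"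


definition fourier :: "(real \<Rightarrow> real) \<Rightarrow> real \<Rightarrow> complex" where
  "fourier K \<xi> = (LINT x|lborel. cis (- (\<xi> * x)) * complex_of_real (K x))"

text \<open>The sign condition does not depend on the normalisation of the Fourier transform.\<close>

definition kernel_assm :: "(real \<Rightarrow> real) \<Rightarrow> bool" where
  "kernel_assm K \<longleftrightarrow>
     integrable lborel K \<and>
     (AE x in lborel. K (- x) = K x) \<and>
     (LINT x|lborel. K x) = 0 \<and>
     (\<forall>\<xi>. \<xi> \<noteq> 0 \<longrightarrow> Im (fourier K \<xi>) = 0 \<and> Re (fourier K \<xi>) \<le> 0)"

definition v0_assm :: "(real \<Rightarrow> real) \<Rightarrow> bool" where
  "v0_assm v0 \<longleftrightarrow>
     in_Linf UNIV v0 \<and> continuous_on UNIV v0 \<and> mono v0 \<and>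
     (\<exists>g. weak_deriv v0 g \<and> integrable lborel g \<and> in_LlogL UNIV g)"

definition mean_slope :: "(real \<Rightarrow> real) \<Rightarrow> real \<Rightarrow> real" where
  "mean_slope v0 P = (v0 P - v0 (- P)) / (2 * P)"

definition initial_data :: "real \<Rightarrow> real \<Rightarrow> (real \<Rightarrow> real) \<Rightarrow> bool" where
  "initial_data P L u0 \<longleftrightarrow>
     per P u0 \<and> continuous_on UNIV u0 \<and> in_Linf {-P..P} u0 \<and>
     (\<exists>g. per P g \<and> weak_deriv u0 g \<and>
          set_integrable lborel {-P..P} g \<and> in_LlogL {-P..P} g) \<and>
     mono_on {-P..<P} (\<lambda>x. u0 x + L * x)"


text \<open>At odd multiples of \<open>P\<close> the value \<open>K (-P)\<close> is used; these points form a null set.\<close>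

definition periodize :: "real \<Rightarrow> (real \<Rightarrow> real) \<Rightarrow> real \<Rightarrow> real" where
  "periodize P K x = K (x - 2 * P * of_int \<lfloor>(x + P) / (2 * P)\<rfloor>)"

definition conv_per :: "real \<Rightarrow> (real \<Rightarrow> real) \<Rightarrow> (real \<Rightarrow> real) \<Rightarrow> real \<Rightarrow> real" where
  "conv_per P w z x = (LINT y:{-P..P}|lborel. w (x - y) * z y)"

text \<open>The exponential sum is real because the frequencies \<open>k\<close> and \<open>-k\<close> both occur.\<close>

definition fejer :: "real \<Rightarrow> nat \<Rightarrow> real \<Rightarrow> real" where
  "fejer P m x =
     Re (1 / of_nat m * (\<Sum>l<m. \<Sum>k\<in>{- int l..int l}.
           exp (\<i> * complex_of_real (pi * of_int k * x / P))))"

definition kernel_PM :: "real \<Rightarrow> (real \<Rightarrow> real) \<Rightarrow> nat \<Rightarrow> real \<Rightarrow> real" where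
  "kernel_PM P K M x =
     periodize P K x - 2 * fejer P (2 * M) x / P * (LINT y:{y. \<bar>y\<bar> \<ge> P}|lborel. \<bar>K y\<bar>)"

definition sigma_PM :: "real \<Rightarrow> (real \<Rightarrow> real) \<Rightarrow> nat \<Rightarrow> real \<Rightarrow> real" where
  "sigma_PM P K M x = 1 / (2 * P) * conv_per P (fejer P M) (kernel_PM P K M) x"


definition mesh :: "real \<Rightarrow> nat \<Rightarrow> real" where
  "mesh P N = P / real N"

definition lam :: "real \<Rightarrow> (real \<Rightarrow> real) \<Rightarrow> nat \<Rightarrow> nat \<Rightarrow> (int \<Rightarrow> real) \<Rightarrow> int \<Rightarrow> real" where
  "lam P K M N v i =
     (\<Sum>j\<in>{0..<2 * int N}. mesh P N * sigma_PM P K M (of_int j * mesh P N) * v (i - j))"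

definition pos_part :: "real \<Rightarrow> real" where
  "pos_part a = (\<bar>a\<bar> + a) / 2"

definition neg_part :: "real \<Rightarrow> real" where
  "neg_part a = (\<bar>a\<bar> - a) / 2"

text \<open>\<open>theta P N v i\<close> is \<open>\<theta>\<close> at the index \<open>i + 1/2\<close>.\<close>

definition theta :: "real \<Rightarrow> nat \<Rightarrow> (int \<Rightarrow> real) \<Rightarrow> int \<Rightarrow> real" where
  "theta P N v i = (v (i + 1) - v i) / mesh P N"

definition scheme_step ::
    "real \<Rightarrow> (real \<Rightarrow> real) \<Rightarrow> nat \<Rightarrow> nat \<Rightarrow> real \<Rightarrow> real \<Rightarrow> (int \<Rightarrow> real) \<Rightarrow> (int \<Rightarrow> real) \<Rightarrow> bool" where
  "scheme_step P K M N L dt v w \<longleftrightarrow>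
     (\<forall>i. (w i - v i) / dt =
            pos_part (lam P K M N w i) * theta P N v i
          - neg_part (lam P K M N w i) * theta P N v (i - 1)
          + L * lam P K M N w i)"

definition admissible_step ::
    "real \<Rightarrow> (real \<Rightarrow> real) \<Rightarrow> nat \<Rightarrow> nat \<Rightarrow> real \<Rightarrow> real \<Rightarrow> real \<Rightarrow> (int \<Rightarrow> real) \<Rightarrow> (int \<Rightarrow> real) \<Rightarrow> bool" where
  "admissible_step P K M N L dt A v w \<longleftrightarrow>
     per_vec N w \<and>
     scheme_step P K M N L dt v w \<and>
     (MAX i\<in>{0..<2 * int N}. \<bar>w i\<bar>) \<le> A \<and>
     (\<forall>i. theta P N w i + L \<ge> 0)"

definition TV_vec :: "nat \<Rightarrow> (int \<Rightarrow> real) \<Rightarrow> real" where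
  "TV_vec N v = (\<Sum>i\<in>{0..<2 * int N}. \<bar>v (i + 1) - v i\<bar>)"

text \<open>The intended domain is \<open>x \<ge> 0\<close>; the value \<open>0\<close> at negative \<open>x\<close> is a convention.\<close>

definition entropy_f :: "real \<Rightarrow> real" where
  "entropy_f x = (if x \<ge> 1 / exp 1 then x * ln x + 1 / exp 1 else 0)"

definition entropy_vec :: "real \<Rightarrow> nat \<Rightarrow> real \<Rightarrow> (int \<Rightarrow> real) \<Rightarrow> real" where
  "entropy_vec P N L v =
     (\<Sum>i\<in>{0..<2 * int N}. mesh P N * entropy_f (theta P N v i + L))"

text \<open>
  Here \<open>\<kappa>\<close> is the \<open>L\<^sup>1\<close> norm of the kernel and \<open>A\<close> the a priori bound.  The quotients are
  taken in \<^typ>\<open>ereal\<close>, where \<open>1 / 0 = \<infinity>\<close>.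
\<close>

definition step_size_cond :: "real \<Rightarrow> real \<Rightarrow> real \<Rightarrow> real \<Rightarrow> real \<Rightarrow> bool" where
  "step_size_cond L \<kappa> A dt dx \<longleftrightarrow>
     ereal dt < 1 / ereal (10 * L * \<kappa>) * min (1 / ereal (A + 1)) 1 \<and>
     ereal (dt / dx) < 1 / ereal (10 * \<kappa>) * min (1 / ereal (A + 1)) (1 / ereal (3 * A))"

end

theory Submission
  imports Defs
begin

text \<open>
  Put \<open>\<rho> = \<theta> + L\<close> and \<open>r = \<Delta>t/\<Delta>x\<close>.  In terms of \<open>\<rho>\<close> the scheme transports:
  \<open>\<rho>\<^sup>n\<^sup>+\<^sup>1\<close> is obtained from \<open>\<rho>\<^sup>n\<close> by a nonnegative matrix with column sums \<open>1\<close> and row sums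
  \<open>1 + r (\<lambda>\<^sub>i\<^sub>+\<^sub>1 - \<lambda>\<^sub>i)\<close>.  Two properties of the kernel suffice.  Since \<open>F\<^sub>M\<close> is nonnegative and
  its Riemann sums on the grid are exact (\<open>M \<le> N\<close>), the discrete \<open>L\<^sup>1\<close> norm of \<open>\<sigma>\<close> is at most that of
  the regularized kernel, hence at most \<open>4\<kappa>\<close>; and the correction by \<open>F\<^sub>2\<^sub>M\<close> makes all Fourier
  coefficients of index \<open>|k| < M\<close> nonpositive, so that \<open>\<lambda>\<close> is of negative type.

  The first property makes the implicit step a contraction and gives the growth factor
  \<open>1/(1 - 4L\<kappa>\<Delta>t) \<le> exp (10L\<kappa>\<Delta>t)\<close> for the sup norm and the total variation.  For the entropy one
  uses the tangent of a convex \<open>G\<close> at \<open>\<rho>\<^sup>n\<^sup>+\<^sup>1\<close>.  For \<open>G x = x ln x\<close> the error term is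
  \<open>\<Sum>\<rho>\<^sup>n\<^sup>+\<^sup>1(\<lambda>\<^sub>i\<^sub>+\<^sub>1 - \<lambda>\<^sub>i) \<le> 0\<close>; for \<open>G = f\<close> it is in addition bounded by a multiple of the total variation.
  The growth factor of the latter depends on \<open>L\<close>, so the constant is obtained from \<open>G = f\<close> only
  if \<open>L < 1\<close>.  For \<open>L \<ge> 1\<close> one uses that \<open>\<Sum>\<rho> ln \<rho>\<close> decreases and that \<open>x ln x + 1/e\<close> exceeds \<open>f x\<close>
  only for \<open>x < 1/e\<close>, by at most \<open>1/e \<le> |x - L|\<close>, which costs one total variation of the initial data.
\<close>

section \<open>The Fejer kernel and the discrete interaction kernel\<close>

lemma fejer_eq:
  "fejer P m x = (\<Sum>l<m. \<Sum>k\<in>{- int l..int l}. cos (of_int k * (pi * x / P))) / real m"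
proof -
  have "Re (exp (\<i> * complex_of_real (pi * of_int k * x / P))) = cos (of_int k * (pi * x / P))" for k
    by (simp add: Re_exp mult_ac)
  moreover have "Re (1 / of_nat m * z) = Re z / real m" for z
    by (simp add: Re_divide_of_nat)
  ultimately show ?thesis
    by (simp add: fejer_def del: of_real_mult of_real_divide)
qed

lemma dirichlet_sum_eq:
  fixes t :: real
  shows "(\<Sum>k\<in>{- int l..int l}. cos (of_int k * t)) = 1 + 2 * (\<Sum>j<l. cos (real (Suc j) * t))"
proof (induction l)
  case (Suc l)
  have "{- int (Suc l)..int (Suc l)} = insert (int (Suc l)) (insert (- int (Suc l)) {- int l..int l})"
    by auto
  moreover have "cos (of_int (- int (Suc l)) * t) = cos (of_int (int (Suc l)) * t)"
    by (simp only: of_int_minus mult_minus_left cos_minus)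
  ultimately show ?case
    using Suc by (simp del: of_nat_Suc of_int_minus)
qed simp

text \<open>The right side is the squared modulus of the exponential sum over the frequencies
  \<open>j < m\<close>. Induction on \<open>m\<close> reaches this form without dividing by
  \<open>sin (t / 2)\<close>, so multiples of \<open>2 * pi\<close> need no separate case.\<close>

lemma fejer_sum_eq_sum_squares:
  fixes t :: real
  shows "(\<Sum>l<m. \<Sum>k\<in>{- int l..int l}. cos (of_int k * t))
           = (\<Sum>j<m. cos (real j * t))\<^sup>2 + (\<Sum>j<m. sin (real j * t))\<^sup>2"
proof (induction m)
  case (Suc m)
  \<comment> \<open>Reversing the order of summation turns the new Dirichlet terms into the cross
    term of the enlarged squares.\<close>
  have "(\<Sum>j<m. cos (real (Suc j) * t)) = (\<Sum>j<m. cos (real (m - j) * t))"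
    by (subst sum.nat_diff_reindex[symmetric]) (rule sum.cong, auto simp: Suc_diff_Suc simp del: of_nat_Suc)
  also have "\<dots> = (\<Sum>j<m. cos (real m * t) * cos (real j * t) + sin (real m * t) * sin (real j * t))"
    by (rule sum.cong) (auto simp: of_nat_diff left_diff_distrib cos_diff)
  also have "\<dots> = cos (real m * t) * (\<Sum>j<m. cos (real j * t)) + sin (real m * t) * (\<Sum>j<m. sin (real j * t))"
    by (simp add: sum.distrib sum_distrib_left)
  finally have *: "(\<Sum>j<m. cos (real (Suc j) * t)) = \<dots>" .
  have "c\<^sup>2 + s\<^sup>2 = 1 \<Longrightarrow> C\<^sup>2 + S\<^sup>2 + (1 + 2 * (c * C + s * S)) = (C + c)\<^sup>2 + (S + s)\<^sup>2"
    for c s C S :: real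
    by algebra
  from this[OF sin_cos_squared_add2] show ?case
    unfolding sum.lessThan_Suc Suc.IH unfolding dirichlet_sum_eq * .
qed simp

lemma fejer_nonneg: "0 \<le> fejer P m x"
  unfolding fejer_eq fejer_sum_eq_sum_squares by simp

lemma continuous_on_cos_freq:
  fixes f :: "real \<Rightarrow> real"
  shows "continuous_on S f \<Longrightarrow> continuous_on S (\<lambda>x. cos (c * (pi * f x / P)))"
  unfolding divide_inverse
  by (rule continuous_on_cos) (intro continuous_on_mult continuous_on_const)

lemma continuous_on_fejer:
  fixes f :: "real \<Rightarrow> real"
  shows "continuous_on S f \<Longrightarrow> continuous_on S (\<lambda>x. fejer P m (f x))"
  unfolding fejer_eq divide_inverse[of _ "real m"]
  by (intro continuous_on_mult continuous_on_sum continuous_on_const continuous_on_cos_freq)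

lemma fejer_periodic:
  assumes "P \<noteq> 0"
  shows "fejer P m (x + 2 * P * of_int n) = fejer P m x"
proof -
  have "cos (of_int k * (pi * (x + 2 * P * of_int n) / P)) = cos (of_int k * (pi * x / P))" for k
  proof -
    have "of_int k * (pi * (x + 2 * P * of_int n) / P) = of_int k * (pi * x / P) + 2 * pi * of_int (k * n)"
      using assms by (simp add: field_simps)
    then show ?thesis
      by (simp only: cos_add cos_int_2pin sin_int_2pin mult_1_right mult_zero_right diff_zero)
  qed
  then show ?thesis by (simp add: fejer_eq)
qed

text \<open>Multiplied by \<open>2 * sin (h / 2)\<close> the sum telescopes, and its two ends agree
  because \<open>h * real n\<close> is a multiple of \<open>2 * pi\<close>.\<close>

lemma sum_cos_grid_eq_0:
  fixes h c :: real and n :: nat and k :: int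
  assumes "h * real n = 2 * pi * of_int k" "sin (h / 2) \<noteq> 0"
  shows "(\<Sum>j<n. cos (real j * h + c)) = 0"
proof -
  have "2 * sin (h / 2) * cos (real j * h + c)
      = sin (real (Suc j) * h - h / 2 + c) - sin (real j * h - h / 2 + c)" for j
  proof -
    have "real (Suc j) * h - h / 2 + c = (real j * h + c) + h / 2"
      "real j * h - h / 2 + c = (real j * h + c) - h / 2" by (simp_all add: algebra_simps)
    then show ?thesis by (simp only: sin_add[of _ "h / 2"] sin_diff[of _ "h / 2"]) simp
  qed
  then have "2 * sin (h / 2) * (\<Sum>j<n. cos (real j * h + c))
      = (\<Sum>j<n. sin (real (Suc j) * h - h / 2 + c) - sin (real j * h - h / 2 + c))"
    by (simp add: sum_distrib_left)
  also have "\<dots> = sin (real n * h - h / 2 + c) - sin (- h / 2 + c)"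
    by (subst sum_lessThan_telescope) simp
  also have "real n * h - h / 2 + c = (- h / 2 + c) + 2 * pi * of_int k"
    using assms(1) by (simp add: algebra_simps)
  also have "sin \<dots> - sin (- h / 2 + c) = 0"
    by (simp only: sin_add cos_int_2pin sin_int_2pin) simp
  finally show ?thesis using assms(2) by simp
qed

text \<open>Exactness of the trapezoidal rule: the frequencies satisfy
  \<open>|k| \<le> l < m \<le> 2 * N\<close>, so no nonzero one is a multiple of
  \<open>2 * N\<close>, and only the constant mode survives, once in each of the \<open>m\<close>
  Dirichlet sums. The shift \<open>y\<close> is free because the sum is later taken inside a
  convolution.\<close>

lemma sum_fejer_grid:
  assumes "P > 0" "0 < m" "m \<le> 2 * N"
  shows "(\<Sum>j<2 * N. mesh P N * fejer P m (of_nat j * mesh P N - y)) = 2 * P"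
proof -
  have N: "N > 0" using assms by auto
  have *: "(\<Sum>j<2 * N. cos (of_int k * (pi * (of_nat j * mesh P N - y) / P))) = (if k = 0 then 2 * real N else 0)"
    if "l < m" "k \<in> {- int l..int l}" for k l
  proof (cases "k = 0")
    case False
    define h where "h = pi * of_int k / real N"
    have "sin (h / 2) \<noteq> 0"
    proof
      assume "sin (h / 2) = 0"
      then obtain i :: int where i: "h / 2 = of_int i * pi" using sin_zero_iff_int2 by blast
      then have "of_int k = (of_int (2 * int N * i) :: real)" using N by (simp add: h_def field_simps)
      then have k: "k = 2 * int N * i" by (simp only: of_int_eq_iff)
      then have "i \<noteq> 0" using False by auto
      then have "2 * int N * 1 \<le> 2 * int N * \<bar>i\<bar>" by (intro mult_left_mono) auto
      then have "2 * int N \<le> \<bar>k\<bar>" using k by (simp add: abs_mult)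
      then show False using that assms by auto
    qed
    moreover have "h * real (2 * N) = 2 * pi * of_int k" using N by (simp add: h_def)
    moreover have "of_int k * (pi * (of_nat j * mesh P N - y) / P) = real j * h + (- of_int k * pi * y / P)" for j :: nat
      using N assms by (simp add: h_def mesh_def field_simps)
    ultimately show ?thesis using False sum_cos_grid_eq_0[of h "2 * N" k] by (simp only: if_False not_False_eq_True)
  qed simp
  have "(\<Sum>j<2 * N. fejer P m (of_nat j * mesh P N - y))
     = (\<Sum>l<m. \<Sum>k\<in>{- int l..int l}. \<Sum>j<2 * N. cos (of_int k * (pi * (of_nat j * mesh P N - y) / P))) / real m"
    unfolding fejer_eq sum_divide_distrib[symmetric]
    by (subst sum.swap) (subst sum.swap, simp)
  also have "(\<Sum>l<m. \<Sum>k\<in>{- int l..int l}. \<Sum>j<2 * N. cos (of_int k * (pi * (of_nat j * mesh P N - y) / P)))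
     = (\<Sum>l<m. \<Sum>k\<in>{- int l..int l}. if k = 0 then 2 * real N else 0)"
    by (intro sum.cong refl *) auto
  also have "\<dots> = real m * (2 * real N)" by simp
  finally show ?thesis
    unfolding sum_distrib_left[symmetric] using assms N by (simp add: mesh_def)
qed

section \<open>Integrals over one period\<close>

lemma set_integral_cos:
  fixes k :: int
  assumes "P > 0"
  shows "(LINT y:{-P..P}|lborel. cos (of_int k * (pi * y / P))) = (if k = 0 then 2 * P else 0)"
proof (cases "k = 0")
  case True
  then show ?thesis using assms by (simp add: set_lebesgue_integral_def)
next
  case False
  define a where "a = of_int k * pi / P"
  have a: "a \<noteq> 0" using False assms by (simp add: a_def)
  have e: "of_int k * (pi * y / P) = a * y" for y by (simp add: a_def)
  have "(LBINT y. cos (a * y) * indicator {-P..P} y) = sin (a * P) / a - sin (a * (-P)) / a"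
    by (rule integral_FTC_Icc_real) (use a assms in \<open>auto intro!: derivative_eq_intros continuous_intros\<close>)
  moreover have "sin (a * P) = 0" using assms by (simp add: a_def mult.commute[of _ pi])
  ultimately show ?thesis using False
    unfolding set_lebesgue_integral_def e by (simp add: mult.commute)
qed

lemma set_integrable_continuous_mult:
  fixes f g :: "real \<Rightarrow> real"
  assumes f: "continuous_on UNIV f" and g: "set_integrable lborel {a..b} g"
  shows "set_integrable lborel {a..b} (\<lambda>y. f y * g y)"
proof -
  have "bounded (f ` {a..b})"
    using f by (intro compact_imp_bounded compact_continuous_image) (auto intro: continuous_on_subset)
  then obtain B where B: "\<And>y. y \<in> {a..b} \<Longrightarrow> \<bar>f y\<bar> \<le> B"
    unfolding bounded_iff by (metis image_eqI real_norm_def)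
  have [measurable]: "f \<in> borel_measurable borel" using f by (rule borel_measurable_continuous_onI)
  show ?thesis
    unfolding set_integrable_def
  proof (rule Bochner_Integration.integrable_bound)
    show "integrable lborel (\<lambda>y. B * \<bar>indicat_real {a..b} y *\<^sub>R g y\<bar>)"
      using g by (auto simp: set_integrable_def intro!: integrable_mult_right)
    have [measurable]: "(\<lambda>y. indicat_real {a..b} y *\<^sub>R g y) \<in> borel_measurable borel"
      using g by (auto simp: set_integrable_def dest!: borel_measurable_integrable)
    have "(\<lambda>y. f y * (indicat_real {a..b} y *\<^sub>R g y)) \<in> borel_measurable borel" by measurable
    then show "(\<lambda>y. indicat_real {a..b} y *\<^sub>R (f y * g y)) \<in> borel_measurable lborel"
      by (simp add: mult_ac)
    have "\<bar>f y\<bar> * \<bar>g y\<bar> \<le> \<bar>B\<bar> * \<bar>g y\<bar>" if "y \<in> {a..b}" for y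
      using B[OF that] by (intro mult_right_mono) auto
    then show "AE y in lborel. norm (indicat_real {a..b} y *\<^sub>R (f y * g y)) \<le> norm (B * \<bar>indicat_real {a..b} y *\<^sub>R g y\<bar>)"
      by (intro AE_I2) (simp add: indicator_def abs_mult)
  qed
qed

lemma set_integrable_continuous:
  fixes f :: "real \<Rightarrow> real"
  shows "continuous_on UNIV f \<Longrightarrow> set_integrable lborel {a..b} f"
  by (rule borel_integrable_atLeastAtMost') (auto intro: continuous_on_subset)

lemma set_integral_cos_mult_cos:
  fixes k k' :: int
  assumes "P > 0"
  shows "(LINT y:{-P..P}|lborel. cos (of_int k * (pi * y / P)) * cos (of_int k' * (pi * y / P)))
     = P * (of_bool (k' = k) + of_bool (k' = - k))"
proof -
  have *: "cos (of_int k * (pi * y / P)) * cos (of_int k' * (pi * y / P))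
     = cos (of_int (k - k') * (pi * y / P)) / 2 + cos (of_int (k + k') * (pi * y / P)) / 2" for y
    unfolding of_int_add of_int_diff distrib_right left_diff_distrib cos_add cos_diff
    by (simp add: field_simps)
  have **: "set_integrable lborel {-P..P} (\<lambda>y. cos (of_int j * (pi * y / P)) / 2)" for j
    by (intro set_integrable_continuous set_integrable_divide continuous_on_cos_freq continuous_on_id)
  have "k - k' = 0 \<longleftrightarrow> k' = k" "k + k' = 0 \<longleftrightarrow> k' = - k" by auto
  then show ?thesis
    unfolding * set_integral_add(2)[OF ** **] set_integral_divide_zero set_integral_cos[OF assms]
    by (simp only: of_bool_def) simp
qed

lemma set_integral_sum:
  fixes f :: "'i \<Rightarrow> 'a \<Rightarrow> real"
  assumes "\<And>i. i \<in> I \<Longrightarrow> set_integrable M S (f i)"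
  shows "(LINT x:S|M. (\<Sum>i\<in>I. f i x)) = (\<Sum>i\<in>I. LINT x:S|M. f i x)"
  using assms unfolding set_integrable_def set_lebesgue_integral_def scaleR_sum_right
  by (rule Bochner_Integration.integral_sum)

text \<open>The frequency \<open>k\<close> occurs in the Dirichlet sum of index \<open>l\<close> iff
  \<open>|k| \<le> l\<close>, that is in \<open>m - |k|\<close> of the \<open>m\<close> averaged
  sums; hence the triangular weight.\<close>

lemma set_integral_cos_mult_fejer:
  assumes "P > 0" "m > 0" "\<bar>k\<bar> \<le> int m"
  shows "(LINT y:{-P..P}|lborel. cos (of_int k * (pi * y / P)) * fejer P m y)
           = 2 * P * (1 - of_int \<bar>k\<bar> / real m)"
proof -
  \<comment> \<open>For \<open>k = 0\<close> both indicators hit the same index, otherwise they hit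
    \<open>k\<close> and \<open>- k\<close>; the total is \<open>2 * P\<close> either way.\<close>
  have inner: "(\<Sum>k'\<in>{- int l..int l}. P * (of_bool (k' = k) + of_bool (k' = - k)))
     = (if nat \<bar>k\<bar> \<le> l then 2 * P else 0)" for l
  proof -
    have "\<bar>k\<bar> \<le> int l \<longleftrightarrow> nat \<bar>k\<bar> \<le> l" by auto
    moreover have "k \<in> {- int l..int l} \<longleftrightarrow> \<bar>k\<bar> \<le> int l" "- k \<in> {- int l..int l} \<longleftrightarrow> \<bar>k\<bar> \<le> int l" by auto
    ultimately show ?thesis
      by (simp only: sum_distrib_left[symmetric] sum.distrib of_bool_def sum.delta finite_atLeastAtMost_int) auto
  qed
  let ?c = "\<lambda>k' y. cos (of_int k * (pi * y / P)) * cos (of_int k' * (pi * y / P))"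
  have cont: "continuous_on UNIV (?c k')" for k'
    by (intro continuous_on_mult continuous_on_cos_freq continuous_on_id)
  have "(LINT y:{-P..P}|lborel. cos (of_int k * (pi * y / P)) * fejer P m y)
     = (LINT y:{-P..P}|lborel. (\<Sum>l<m. \<Sum>k'\<in>{- int l..int l}. ?c k' y) / real m)"
    by (simp only: fejer_eq sum_distrib_left times_divide_eq_right)
  also have "\<dots> = (LINT y:{-P..P}|lborel. (\<Sum>l<m. \<Sum>k'\<in>{- int l..int l}. ?c k' y)) / real m"
    by (rule set_integral_divide_zero)
  also have "(LINT y:{-P..P}|lborel. (\<Sum>l<m. \<Sum>k'\<in>{- int l..int l}. ?c k' y))
     = (\<Sum>l<m. LINT y:{-P..P}|lborel. (\<Sum>k'\<in>{- int l..int l}. ?c k' y))"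
    by (intro set_integral_sum set_integrable_continuous continuous_on_sum cont)
  also have "\<dots> = (\<Sum>l<m. \<Sum>k'\<in>{- int l..int l}. LINT y:{-P..P}|lborel. ?c k' y)"
    by (intro sum.cong refl set_integral_sum set_integrable_continuous cont)
  also have "\<dots> = (\<Sum>l<m. if nat \<bar>k\<bar> \<le> l then 2 * P else 0)"
    unfolding set_integral_cos_mult_cos[OF assms(1)] inner ..
  also have "(\<Sum>l<m. if nat \<bar>k\<bar> \<le> l then 2 * P else 0) = 2 * P * real (card {nat \<bar>k\<bar>..<m})"
  proof -
    have "{l. l < m \<and> nat \<bar>k\<bar> \<le> l} = {nat \<bar>k\<bar>..<m}" by auto
    then show ?thesis by (simp add: sum.If_cases Int_def)
  qed
  also have "real (card {nat \<bar>k\<bar>..<m}) = real m - of_int \<bar>k\<bar>"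
    using assms by (simp add: of_nat_diff nat_le_iff)
  also have "2 * P * (real m - of_int \<bar>k\<bar>) / real m = 2 * P * (1 - of_int \<bar>k\<bar> / real m)"
    using assms(2) by (simp only: right_diff_distrib diff_divide_distrib) simp
  finally show ?thesis .
qed

lemma set_integral_fejer:
  assumes "P > 0" "m > 0"
  shows "(LINT y:{-P..P}|lborel. fejer P m y) = 2 * P"
  using set_integral_cos_mult_fejer[OF assms, of 0] by simp

lemma set_integrable_sum:
  fixes f :: "'i \<Rightarrow> 'a \<Rightarrow> real"
  assumes "\<And>i. i \<in> I \<Longrightarrow> set_integrable M S (f i)"
  shows "set_integrable M S (\<lambda>x. \<Sum>i\<in>I. f i x)"
  using assms unfolding set_integrable_def scaleR_sum_right by (rule Bochner_Integration.integrable_sum)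

text \<open>The two sets cover the line and overlap at most in \<open>P\<close> and
  \<open>- P\<close>, a null set.\<close>

lemma set_integral_Icc_eq_diff:
  fixes g :: "real \<Rightarrow> real"
  assumes g: "integrable lborel g"
  shows "(LINT y:{-P..P}|lborel. g y) = (LINT y|lborel. g y) - (LINT y:{y. \<bar>y\<bar> \<ge> P}|lborel. g y)"
proof -
  have [measurable]: "g \<in> borel_measurable borel"
    using g by (auto dest: borel_measurable_integrable)
  have i: "integrable lborel (\<lambda>y. indicat_real {y. \<bar>y\<bar> \<ge> P} y *\<^sub>R g y)"
    by (rule integrable_mult_indicator[OF _ g]) auto
  have "(LINT y:{-P..P}|lborel. g y) = (LINT y|lborel. g y - indicat_real {y. \<bar>y\<bar> \<ge> P} y *\<^sub>R g y)"
    unfolding set_lebesgue_integral_def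
  proof (rule integral_cong_AE)
    show "AE y in lborel. indicat_real {-P..P} y *\<^sub>R g y = g y - indicat_real {y. \<bar>y\<bar> \<ge> P} y *\<^sub>R g y"
      using AE_lborel_singleton[of P] AE_lborel_singleton[of "- P"]
      by eventually_elim (auto simp: indicator_def)
  qed measurable
  also have "\<dots> = (LINT y|lborel. g y) - (LINT y:{y. \<bar>y\<bar> \<ge> P}|lborel. g y)"
    unfolding set_lebesgue_integral_def by (rule Bochner_Integration.integral_diff[OF g i])
  finally show ?thesis .
qed

section \<open>The periodized and regularized kernel\<close>

lemma periodize_eq: "P > 0 \<Longrightarrow> - P \<le> y \<Longrightarrow> y < P \<Longrightarrow> periodize P K y = K y"
proof -
  assume "P > 0" "- P \<le> y" "y < P"
  then have "\<lfloor>(y + P) / (2 * P)\<rfloor> = 0"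
    by (simp add: floor_eq_iff)
  then show ?thesis by (simp add: periodize_def)
qed

text \<open>The exceptional point is \<open>y = P\<close>, where \<open>periodize\<close> takes the
  value \<open>K (- P)\<close>. The free \<open>h\<close> covers products with a test function as
  well as absolute values.\<close>

lemma periodize_AE_eq:
  fixes h :: "real \<Rightarrow> real \<Rightarrow> real"
  assumes "P > 0"
  shows "AE y in lborel. indicat_real {-P..P} y *\<^sub>R h (periodize P K y) y = indicat_real {-P..P} y *\<^sub>R h (K y) y"
  using AE_lborel_singleton[of P] by eventually_elim (auto simp: indicator_def periodize_eq assms)

locale real_kernel =
  fixes P :: real and K :: "real \<Rightarrow> real"
  assumes P_pos: "P > 0" and K_integrable: "integrable lborel K"
begin

abbreviation "tail \<equiv> (LINT y:{y. \<bar>y\<bar> \<ge> P}|lborel. \<bar>K y\<bar>)"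

lemma K_measurable [measurable]: "K \<in> borel_measurable borel"
  using K_integrable by (auto dest: borel_measurable_integrable)

lemma periodize_measurable [measurable]: "periodize P K \<in> borel_measurable borel"
  unfolding periodize_def by measurable

lemma tail_nonneg: "0 \<le> tail"
  unfolding set_lebesgue_integral_def by (intro integral_nonneg_AE) auto

lemma set_integrable_periodize: "set_integrable lborel {-P..P} (periodize P K)"
proof -
  have "integrable lborel (\<lambda>y. indicat_real {-P..P} y *\<^sub>R K y)"
    by (rule integrable_mult_indicator[OF _ K_integrable]) auto
  then show ?thesis
    unfolding set_integrable_def
  proof (rule integrable_cong_AE_imp)
    show "AE y in lborel. indicat_real {-P..P} y *\<^sub>R K y = indicat_real {-P..P} y *\<^sub>R periodize P K y"
      using periodize_AE_eq[OF P_pos, where h = "\<lambda>x y. x"] by (simp only: eq_commute)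
  qed measurable
qed

lemma set_integral_periodize:
  assumes [measurable]: "h \<in> borel_measurable borel"
  shows "(LINT y:{-P..P}|lborel. h y * periodize P K y) = (LINT y:{-P..P}|lborel. h y * K y)"
  unfolding set_lebesgue_integral_def
  by (rule integral_cong_AE[OF _ _ periodize_AE_eq[OF P_pos, where h = "\<lambda>x y. h y * x"]]) measurable

lemma set_integral_abs_periodize:
  "(LINT y:{-P..P}|lborel. \<bar>periodize P K y\<bar>) = (LINT y:{-P..P}|lborel. \<bar>K y\<bar>)"
  unfolding set_lebesgue_integral_def
  by (rule integral_cong_AE[OF _ _ periodize_AE_eq[OF P_pos, where h = "\<lambda>x y. \<bar>x\<bar>"]]) measurable

lemma kernel_PM_eq: "kernel_PM P K M y = periodize P K y - (2 * tail / P) * fejer P (2 * M) y"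
  by (simp add: kernel_PM_def)

lemma set_integrable_fejer: "set_integrable lborel {-P..P} (\<lambda>y. fejer P m y)"
  by (intro set_integrable_continuous continuous_on_fejer continuous_on_id)

lemma set_integrable_kernel_PM: "set_integrable lborel {-P..P} (kernel_PM P K M)"
  unfolding kernel_PM_eq[abs_def]
  by (intro set_integral_diff(1) set_integrable_periodize set_integrable_mult_right set_integrable_fejer)

text \<open>Since the Fejer kernel is nonnegative with integral \<open>2 * P\<close>, the correction
  has norm exactly \<open>4 * tail\<close>. The uncorrected part has norm
  \<open>L1_norm K - tail\<close>, and \<open>tail \<le> L1_norm K\<close>.\<close>

lemma kernel_PM_L1_bound:
  assumes "M > 0"
  shows "(LINT y:{-P..P}|lborel. \<bar>kernel_PM P K M y\<bar>) \<le> 4 * L1_norm K"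
proof -
  have "(LINT y:{-P..P}|lborel. \<bar>kernel_PM P K M y\<bar>)
     \<le> (LINT y:{-P..P}|lborel. \<bar>periodize P K y\<bar> + (2 * tail / P) * fejer P (2 * M) y)"
  proof (rule set_integral_mono)
    fix y
    have "0 \<le> (2 * tail / P) * fejer P (2 * M) y"
      using tail_nonneg P_pos by (intro mult_nonneg_nonneg fejer_nonneg) auto
    then show "\<bar>kernel_PM P K M y\<bar> \<le> \<bar>periodize P K y\<bar> + (2 * tail / P) * fejer P (2 * M) y"
      unfolding kernel_PM_eq by linarith
  qed (intro set_integrable_abs set_integrable_kernel_PM set_integral_add(1) set_integrable_periodize
      set_integrable_mult_right set_integrable_fejer)+
  also have "\<dots> = (LINT y:{-P..P}|lborel. \<bar>K y\<bar>) + (2 * tail / P) * (2 * P)"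
    using assms P_pos
    by (subst set_integral_add(2))
       (auto intro!: set_integrable_abs set_integrable_periodize set_integrable_mult_right set_integrable_fejer
         simp: set_integral_fejer set_integral_abs_periodize simp del: times_divide_eq_left times_divide_eq_right)
  also have "\<dots> = (LINT y:{-P..P}|lborel. \<bar>K y\<bar>) + 4 * tail"
    using P_pos by simp
  also have "(LINT y:{-P..P}|lborel. \<bar>K y\<bar>) = L1_norm K - tail"
    unfolding L1_norm_def by (rule set_integral_Icc_eq_diff) (use K_integrable in simp)
  also have "L1_norm K - tail + 4 * tail \<le> 4 * L1_norm K"
  proof -
    have "0 \<le> (LINT y:{-P..P}|lborel. \<bar>K y\<bar>)"
      unfolding set_lebesgue_integral_def by (intro integral_nonneg_AE) auto
    moreover have "(LINT y:{-P..P}|lborel. \<bar>K y\<bar>) = L1_norm K - tail" by fact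
    ultimately show ?thesis by linarith
  qed
  finally show ?thesis .
qed

text \<open>On the whole line the cosine coefficient is nonpositive, by the sign condition or, for
  \<open>k = 0\<close>, by the mean value zero. Truncation to one period raises it by at most
  \<open>tail\<close>. The correction subtracts \<open>4 * tail * (1 - |k| / (2 * M))\<close>, which
  is at least \<open>2 * tail\<close>: the order \<open>2 * M\<close> keeps the Fejer weight above
  \<open>1 / 2\<close> for \<open>|k| < M\<close>.\<close>

lemma cos_coeff_kernel_PM_nonpos:
  assumes K0: "(LINT x|lborel. K x) = 0"
    and KF: "\<And>\<xi>. \<xi> \<noteq> 0 \<Longrightarrow> Re (fourier K \<xi>) \<le> 0"
    and k: "\<bar>k\<bar> < int M"
  shows "(LINT y:{-P..P}|lborel. cos (of_int k * (pi * y / P)) * kernel_PM P K M y) \<le> 0"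
proof -
  define \<xi> where "\<xi> = of_int k * pi / P"
  have ang: "of_int k * (pi * y / P) = \<xi> * y" for y by (simp add: \<xi>_def)
  have [measurable]: "(\<lambda>y. cos (\<xi> * y)) \<in> borel_measurable borel" by measurable
  have cK: "integrable lborel (\<lambda>y. cos (\<xi> * y) * K y)"
  proof (rule Bochner_Integration.integrable_bound[OF K_integrable])
    show "AE y in lborel. norm (cos (\<xi> * y) * K y) \<le> norm (K y)"
      by (intro AE_I2) (simp add: abs_mult mult_left_le_one_le)
  qed measurable
  have full: "(LINT y|lborel. cos (\<xi> * y) * K y) \<le> 0"
  proof (cases "\<xi> = 0")
    case True
    then show ?thesis using K0 by simp
  next
    case False
    have "integrable lborel (\<lambda>x. cis (- (\<xi> * x)) * complex_of_real (K x))"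
    proof (rule Bochner_Integration.integrable_bound[OF K_integrable])
      have "continuous_on UNIV (\<lambda>x. cis (- (\<xi> * x)))" by (intro continuous_intros)
      then have [measurable]: "(\<lambda>x. cis (- (\<xi> * x))) \<in> borel_measurable borel"
        by (rule borel_measurable_continuous_onI)
      show "(\<lambda>x. cis (- (\<xi> * x)) * complex_of_real (K x)) \<in> borel_measurable lborel"
        by measurable
    qed (simp add: norm_mult)
    then have "Re (fourier K \<xi>) = (LINT y|lborel. Re (cis (- (\<xi> * y)) * complex_of_real (K y)))"
      unfolding fourier_def by (rule integral_Re[symmetric])
    also have "\<dots> = (LINT y|lborel. cos (\<xi> * y) * K y)" by simp
    finally show ?thesis using KF[OF False] by simp
  qed
  have "- tail \<le> (LINT y:{y. \<bar>y\<bar> \<ge> P}|lborel. cos (\<xi> * y) * K y)"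
  proof -
    have "- tail = (LINT y:{y. \<bar>y\<bar> \<ge> P}|lborel. - \<bar>K y\<bar>)"
      by (simp add: set_lebesgue_integral_def)
    also have "\<dots> \<le> (LINT y:{y. \<bar>y\<bar> \<ge> P}|lborel. cos (\<xi> * y) * K y)"
    proof (rule set_integral_mono)
      show "set_integrable lborel {y. \<bar>y\<bar> \<ge> P} (\<lambda>y. - \<bar>K y\<bar>)"
        unfolding set_integrable_def by (rule integrable_mult_indicator) (use K_integrable in auto)
      show "set_integrable lborel {y. \<bar>y\<bar> \<ge> P} (\<lambda>y. cos (\<xi> * y) * K y)"
        unfolding set_integrable_def by (rule integrable_mult_indicator[OF _ cK]) auto
      show "- \<bar>K y\<bar> \<le> cos (\<xi> * y) * K y" for y
      proof -
        have "\<bar>cos (\<xi> * y) * K y\<bar> \<le> \<bar>K y\<bar>" by (simp add: abs_mult mult_left_le_one_le)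
        then show ?thesis by linarith
      qed
    qed
    finally show ?thesis .
  qed
  then have inner: "(LINT y:{-P..P}|lborel. cos (\<xi> * y) * K y) \<le> tail"
    using set_integral_Icc_eq_diff[OF cK, of P] full by linarith
  have i1: "set_integrable lborel {-P..P} (\<lambda>y. cos (\<xi> * y) * periodize P K y)"
    by (intro set_integrable_continuous_mult set_integrable_periodize continuous_intros)
  have i2: "set_integrable lborel {-P..P} (\<lambda>y. (2 * tail / P) * (cos (\<xi> * y) * fejer P (2 * M) y))"
    by (intro set_integrable_continuous continuous_on_mult continuous_on_fejer continuous_on_cos
        continuous_on_id continuous_on_const)
  have "(LINT y:{-P..P}|lborel. cos (\<xi> * y) * kernel_PM P K M y)
     = (LINT y:{-P..P}|lborel. cos (\<xi> * y) * periodize P K y - (2 * tail / P) * (cos (\<xi> * y) * fejer P (2 * M) y))"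
    unfolding kernel_PM_eq by (simp only: right_diff_distrib mult.left_commute)
  also have "\<dots> = (LINT y:{-P..P}|lborel. cos (\<xi> * y) * periodize P K y)
      - (2 * tail / P) * (LINT y:{-P..P}|lborel. cos (\<xi> * y) * fejer P (2 * M) y)"
    unfolding set_integral_diff(2)[OF i1 i2] by (simp only: set_integral_mult_right)
  also have "(LINT y:{-P..P}|lborel. cos (\<xi> * y) * periodize P K y) = (LINT y:{-P..P}|lborel. cos (\<xi> * y) * K y)"
    by (rule set_integral_periodize) measurable
  also have "(LINT y:{-P..P}|lborel. cos (\<xi> * y) * fejer P (2 * M) y) = 2 * P * (1 - of_int \<bar>k\<bar> / real (2 * M))"
    unfolding ang[symmetric] using k by (intro set_integral_cos_mult_fejer P_pos) auto
  also have "(LINT y:{-P..P}|lborel. cos (\<xi> * y) * K y) - (2 * tail / P) * (2 * P * (1 - of_int \<bar>k\<bar> / real (2 * M))) \<le> 0"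
  proof -
    have "1 / 2 \<le> 1 - of_int \<bar>k\<bar> / real (2 * M)"
      using k by (simp add: field_simps)
    then have "tail * (1 / 2) \<le> tail * (1 - of_int \<bar>k\<bar> / real (2 * M))"
      by (intro mult_left_mono tail_nonneg)
    moreover have "(2 * tail / P) * (2 * P * c) = 4 * (tail * c)" for c
      using P_pos by simp
    ultimately show ?thesis using inner tail_nonneg by (simp only:)
  qed
  finally show ?thesis unfolding ang .
qed

section \<open>Norm and sign of the discrete interaction kernel\<close>

lemma sigma_PM_periodic: "sigma_PM P K M (x + 2 * P * of_int n) = sigma_PM P K M x"
proof -
  have "fejer P M (x + 2 * P * of_int n - y) = fejer P M (x - y)" for y
    using fejer_periodic[of P M "x - y" n] P_pos by (simp add: algebra_simps)
  then show ?thesis by (simp add: sigma_PM_def conv_per_def)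
qed

text \<open>A discrete Young inequality. Positivity of the Fejer kernel moves the absolute value
  onto the other factor; the grid sum is then taken under the integral, where it equals
  \<open>2 * P\<close> for every \<open>y\<close> and cancels the normalisation, without
  discretization error.\<close>

lemma sum_abs_sigma_PM:
  assumes "0 < M" "M \<le> N"
  shows "(\<Sum>j<2 * N. mesh P N * \<bar>sigma_PM P K M (of_nat j * mesh P N)\<bar>) \<le> 4 * L1_norm K"
proof -
  let ?k = "kernel_PM P K M"
  have mesh: "mesh P N \<ge> 0" using P_pos by (simp add: mesh_def)
  have i: "set_integrable lborel {-P..P} (\<lambda>y. fejer P M (x - y) * \<bar>?k y\<bar>)" for x
    by (intro set_integrable_continuous_mult continuous_on_fejer continuous_intros set_integrable_abs
        set_integrable_kernel_PM)
  have *: "\<bar>sigma_PM P K M x\<bar> \<le> (LINT y:{-P..P}|lborel. fejer P M (x - y) * \<bar>?k y\<bar>) / (2 * P)" for x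
  proof -
    have "\<bar>conv_per P (fejer P M) ?k x\<bar> \<le> (LINT y:{-P..P}|lborel. \<bar>fejer P M (x - y) * ?k y\<bar>)"
      unfolding conv_per_def set_lebesgue_integral_def
      by (rule order_trans[OF integral_abs_bound]) (simp add: abs_mult)
    then show ?thesis
      using P_pos by (simp add: sigma_PM_def abs_mult fejer_nonneg divide_right_mono)
  qed
  have "(\<Sum>j<2 * N. mesh P N * \<bar>sigma_PM P K M (of_nat j * mesh P N)\<bar>)
     \<le> (\<Sum>j<2 * N. mesh P N * ((LINT y:{-P..P}|lborel. fejer P M (of_nat j * mesh P N - y) * \<bar>?k y\<bar>) / (2 * P)))"
    by (intro sum_mono mult_left_mono * mesh)
  also have "\<dots> = (LINT y:{-P..P}|lborel. (\<Sum>j<2 * N. mesh P N * (fejer P M (of_nat j * mesh P N - y) * \<bar>?k y\<bar>))) / (2 * P)"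
    by (subst set_integral_sum[OF set_integrable_mult_right[OF i]])
       (simp only: sum_divide_distrib set_integral_mult_right times_divide_eq_right)
  also have "(\<lambda>y. \<Sum>j<2 * N. mesh P N * (fejer P M (of_nat j * mesh P N - y) * \<bar>?k y\<bar>))
      = (\<lambda>y. 2 * P * \<bar>?k y\<bar>)"
    using sum_fejer_grid[OF P_pos, of M N] assms
    by (simp only: mult.assoc[symmetric] sum_distrib_right[symmetric])
  also have "(LINT y:{-P..P}|lborel. 2 * P * \<bar>?k y\<bar>) / (2 * P) = (LINT y:{-P..P}|lborel. \<bar>?k y\<bar>)"
    using P_pos by (simp add: set_integral_mult_right)
  also have "\<dots> \<le> 4 * L1_norm K" by (rule kernel_PM_L1_bound[OF assms(1)])
  finally show ?thesis .
qed

text \<open>The addition theorem separates \<open>x\<close> from \<open>y\<close> in each frequency.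
  The sine coefficients are kept; they cancel in the quadratic form below.\<close>

lemma sigma_PM_fourier:
  "sigma_PM P K M x = (\<Sum>l<M. \<Sum>k\<in>{- int l..int l}.
      cos (of_int k * (pi * x / P)) * (LINT y:{-P..P}|lborel. cos (of_int k * (pi * y / P)) * kernel_PM P K M y)
    + sin (of_int k * (pi * x / P)) * (LINT y:{-P..P}|lborel. sin (of_int k * (pi * y / P)) * kernel_PM P K M y))
      / (2 * P * real M)"
proof -
  let ?k = "kernel_PM P K M"
  let ?a = "\<lambda>k x. real_of_int k * (pi * x / P)"
  let ?g = "\<lambda>k y. cos (?a k x) * (cos (?a k y) * ?k y) + sin (?a k x) * (sin (?a k y) * ?k y)"
  have i: "set_integrable lborel {-P..P} (\<lambda>y. cos (?a k y) * ?k y)"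
      "set_integrable lborel {-P..P} (\<lambda>y. sin (?a k y) * ?k y)" for k
    by (intro set_integrable_continuous_mult set_integrable_kernel_PM continuous_on_cos continuous_on_sin;
        use P_pos in \<open>auto intro!: continuous_intros\<close>)+
  then have ig: "set_integrable lborel {-P..P} (?g k)" for k
    by (intro set_integral_add(1) set_integrable_mult_right)
  have split: "(LINT y:{-P..P}|lborel. ?g k y)
     = cos (?a k x) * (LINT y:{-P..P}|lborel. cos (?a k y) * ?k y)
     + sin (?a k x) * (LINT y:{-P..P}|lborel. sin (?a k y) * ?k y)" for k
    by (simp only: set_integral_add(2)[OF set_integrable_mult_right[OF i(1)] set_integrable_mult_right[OF i(2)]]
        set_integral_mult_right)
  have "?a k (x - y) = ?a k x - ?a k y" for k y
    by (simp add: right_diff_distrib diff_divide_distrib)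
  then have "cos (?a k (x - y)) * ?k y = ?g k y" for k y
    by (simp only: cos_diff distrib_right mult.assoc)
  then have "fejer P M (x - y) * ?k y = (\<Sum>l<M. \<Sum>k\<in>{- int l..int l}. ?g k y) / real M" for y
    by (simp only: fejer_eq sum_distrib_right times_divide_eq_left)
  then have "sigma_PM P K M x = (LINT y:{-P..P}|lborel. (\<Sum>l<M. \<Sum>k\<in>{- int l..int l}. ?g k y) / real M) / (2 * P)"
    by (simp only: sigma_PM_def conv_per_def) simp
  also have "\<dots> = (LINT y:{-P..P}|lborel. (\<Sum>l<M. \<Sum>k\<in>{- int l..int l}. ?g k y)) / (2 * P * real M)"
    by (simp only: set_integral_divide_zero divide_divide_eq_left mult_ac)
  also have "(LINT y:{-P..P}|lborel. (\<Sum>l<M. \<Sum>k\<in>{- int l..int l}. ?g k y))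
     = (\<Sum>l<M. LINT y:{-P..P}|lborel. (\<Sum>k\<in>{- int l..int l}. ?g k y))"
    by (intro set_integral_sum set_integrable_sum ig)
  also have "\<dots> = (\<Sum>l<M. \<Sum>k\<in>{- int l..int l}. LINT y:{-P..P}|lborel. ?g k y)"
    by (intro sum.cong refl set_integral_sum ig)
  finally show ?thesis unfolding split .
qed

end

text \<open>The cosine part is the squared modulus of the sum of \<open>\<theta> i\<close> times the
  unit vector at angle \<open>a i\<close>; the sine part is antisymmetric in \<open>i\<close> and
  \<open>j\<close> and drops out.\<close>

lemma sum_sum_cos_sin:
  fixes a \<theta> :: "'i \<Rightarrow> real"
  shows "(\<Sum>i\<in>I. \<Sum>j\<in>I. \<theta> i * \<theta> j * (cos (a i - a j) * C + sin (a i - a j) * S))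
     = C * ((\<Sum>i\<in>I. \<theta> i * cos (a i))\<^sup>2 + (\<Sum>i\<in>I. \<theta> i * sin (a i))\<^sup>2)"
proof -
  have "\<theta> i * \<theta> j * (cos (a i - a j) * C + sin (a i - a j) * S)
     = C * ((\<theta> i * cos (a i)) * (\<theta> j * cos (a j)) + (\<theta> i * sin (a i)) * (\<theta> j * sin (a j)))
     + S * ((\<theta> i * sin (a i)) * (\<theta> j * cos (a j)) - (\<theta> i * cos (a i)) * (\<theta> j * sin (a j)))" for i j
    by (simp add: cos_diff sin_diff algebra_simps)
  then show ?thesis
    by (simp only: sum.distrib sum_subtractf sum_distrib_left[symmetric] sum_distrib_right[symmetric]
        power2_eq_square) simp
qed

text \<open>With the frequency moved outermost, each one contributes its cosine coefficient times a
  squared modulus, and all frequencies that occur satisfy \<open>|k| < M\<close>.\<close>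

lemma (in real_kernel) sigma_PM_negative_type:
  assumes "(LINT x|lborel. K x) = 0" "\<And>\<xi>. \<xi> \<noteq> 0 \<Longrightarrow> Re (fourier K \<xi>) \<le> 0"
  shows "(\<Sum>i\<in>I. \<Sum>j\<in>I. \<theta> i * \<theta> j * sigma_PM P K M (x i - x j)) \<le> 0"
proof -
  let ?C = "\<lambda>k. LINT y:{-P..P}|lborel. cos (of_int k * (pi * y / P)) * kernel_PM P K M y"
  let ?S = "\<lambda>k. LINT y:{-P..P}|lborel. sin (of_int k * (pi * y / P)) * kernel_PM P K M y"
  let ?a = "\<lambda>k i. of_int k * (pi * x i / P)"
  have a: "of_int k * (pi * (x i - x j) / P) = ?a k i - ?a k j" for k i j
    by (simp add: right_diff_distrib diff_divide_distrib)
  have "sigma_PM P K M (x i - x j) = (\<Sum>l<M. \<Sum>k\<in>{- int l..int l}.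
      cos (?a k i - ?a k j) * ?C k + sin (?a k i - ?a k j) * ?S k) / (2 * P * real M)" for i j
    unfolding sigma_PM_fourier a ..
  then have "(\<Sum>i\<in>I. \<Sum>j\<in>I. \<theta> i * \<theta> j * sigma_PM P K M (x i - x j))
     = (\<Sum>i\<in>I. \<Sum>j\<in>I. \<Sum>l<M. \<Sum>k\<in>{- int l..int l}.
         \<theta> i * \<theta> j * (cos (?a k i - ?a k j) * ?C k + sin (?a k i - ?a k j) * ?S k)) / (2 * P * real M)"
    by (simp only: sum_distrib_left sum_divide_distrib times_divide_eq_right[of _ _ "2 * P * real M"])
  also have "\<dots> = (\<Sum>i\<in>I. \<Sum>l<M. \<Sum>j\<in>I. \<Sum>k\<in>{- int l..int l}.
         \<theta> i * \<theta> j * (cos (?a k i - ?a k j) * ?C k + sin (?a k i - ?a k j) * ?S k)) / (2 * P * real M)"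
    by (subst sum.swap[of _ "{..<M}"]) (rule refl)
  also have "\<dots> = (\<Sum>l<M. \<Sum>i\<in>I. \<Sum>k\<in>{- int l..int l}. \<Sum>j\<in>I.
         \<theta> i * \<theta> j * (cos (?a k i - ?a k j) * ?C k + sin (?a k i - ?a k j) * ?S k)) / (2 * P * real M)"
    by (subst sum.swap[of _ "{..<M}"]) (subst (2) sum.swap, rule refl)
  also have "\<dots> = (\<Sum>l<M. \<Sum>k\<in>{- int l..int l}. \<Sum>i\<in>I. \<Sum>j\<in>I.
         \<theta> i * \<theta> j * (cos (?a k i - ?a k j) * ?C k + sin (?a k i - ?a k j) * ?S k)) / (2 * P * real M)"
    by (subst sum.swap) (rule refl)
  also have "\<dots> \<le> 0"
  proof -
    have "?C k \<le> 0" if "l < M" "k \<in> {- int l..int l}" for l k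
      using that by (intro cos_coeff_kernel_PM_nonpos assms) auto
    then show ?thesis
      unfolding sum_sum_cos_sin using P_pos
      by (intro divide_nonpos_nonneg sum_nonpos mult_nonpos_nonneg add_nonneg_nonneg) auto
  qed
  finally show ?thesis .
qed

section \<open>One step of the implicit scheme\<close>

lemma contraction_fixpoint_unique:
  fixes F :: "('i \<Rightarrow> real) \<Rightarrow> 'i \<Rightarrow> real"
  assumes q: "0 \<le> q" "q < 1"
    and contr: "\<And>D i. (\<And>j. \<bar>x j - y j\<bar> \<le> D) \<Longrightarrow> \<bar>F x i - F y i\<bar> \<le> q * D"
    and bound: "\<And>i. \<bar>x i - y i\<bar> \<le> B"
    and eqs: "F x = x" "F y = y"
  shows "x = y"
proof
  fix i
  have "\<bar>x j - y j\<bar> \<le> q ^ n * B" for n j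
  proof (induction n arbitrary: j)
    case 0
    then show ?case using bound by simp
  next
    case (Suc n)
    then show ?case using contr[of "q ^ n * B" j] eqs by (simp add: mult.assoc)
  qed
  moreover have "(\<lambda>n. q ^ n * B) \<longlonglongrightarrow> 0"
    using q by (intro tendsto_mult_left_zero LIMSEQ_power_zero) auto
  ultimately have "\<bar>x i - y i\<bar> \<le> 0"
    by (intro LIMSEQ_le_const) auto
  then show "x i = y i" by simp
qed

text \<open>Banach iteration. Contractivity is phrased with a common bound \<open>D\<close> on all
  coordinates instead of a norm, and closedness with pointwise limits, so no metric on the function
  space has to be set up.\<close>

lemma contraction_fixpoint_exists:
  fixes F :: "('i \<Rightarrow> real) \<Rightarrow> 'i \<Rightarrow> real"
  assumes q: "0 \<le> q" "q < 1"
    and contr: "\<And>x y D i. x \<in> X \<Longrightarrow> y \<in> X \<Longrightarrow> (\<And>j. \<bar>x j - y j\<bar> \<le> D) \<Longrightarrow> \<bar>F x i - F y i\<bar> \<le> q * D"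
    and bound: "\<And>x i. x \<in> X \<Longrightarrow> \<bar>x i\<bar> \<le> B"
    and closed: "\<And>f x. (\<And>n. f n \<in> X) \<Longrightarrow> (\<And>i. (\<lambda>n. f n i) \<longlonglongrightarrow> x i) \<Longrightarrow> x \<in> X"
    and x0: "x0 \<in> X" and maps: "\<And>x. x \<in> X \<Longrightarrow> F x \<in> X"
  shows "\<exists>x\<in>X. F x = x"
proof -
  define W where "W n = (F ^^ n) x0" for n
  have W_Suc: "W (Suc n) = F (W n)" for n by (simp add: W_def)
  have WX: "W n \<in> X" for n by (induction n) (auto simp: W_Suc x0 maps, simp add: W_def x0)
  have step: "\<bar>W (Suc n) i - W n i\<bar> \<le> q ^ n * (2 * B)" for n i
  proof (induction n arbitrary: i)
    case 0
    show ?case using bound[OF WX, of 0 i] bound[OF WX, of "Suc 0" i] by simp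
  next
    case (Suc n)
    then show ?case using contr[OF WX WX, of "Suc n" n "q ^ n * (2 * B)" i] by (simp add: W_Suc mult.assoc)
  qed
  have "convergent (\<lambda>n. W n i)" for i
  proof -
    have "summable (\<lambda>n. W (Suc n) i - W n i)"
    proof (rule summable_comparison_test[of _ "\<lambda>n. q ^ n * (2 * B)"])
      show "\<exists>N. \<forall>n\<ge>N. norm (W (Suc n) i - W n i) \<le> q ^ n * (2 * B)" using step by auto
      show "summable (\<lambda>n. q ^ n * (2 * B))" using q by (intro summable_mult2 summable_geometric) auto
    qed
    then have "convergent (\<lambda>n. \<Sum>k<n. W (Suc k) i - W k i)" by (simp add: summable_iff_convergent)
    then have "convergent (\<lambda>n. W n i - W 0 i)" by (simp only: sum_lessThan_telescope[of "\<lambda>n. W n i"])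
    then show ?thesis by (simp add: convergent_diff_const_right_iff)
  qed
  then have "\<forall>i. \<exists>l. (\<lambda>n. W n i) \<longlonglongrightarrow> l" by (simp add: convergent_def)
  then obtain w where w: "\<And>i. (\<lambda>n. W n i) \<longlonglongrightarrow> w i" by metis
  then have wX: "w \<in> X" using WX by (rule closed[rotated])
  \<comment> \<open>Pointwise convergence is not enough to pass \<open>F\<close> to the limit; the
    geometric series gives a bound uniform in \<open>i\<close>, to which \<open>contr\<close>
    applies.\<close>
  have tail: "\<bar>w i - W n i\<bar> \<le> q ^ n * (2 * B) / (1 - q)" for n i
  proof -
    have part: "\<bar>W (n + m) i - W n i\<bar> \<le> q ^ n * (2 * B) * (\<Sum>k<m. q ^ k)" for m
    proof (induction m)
      case (Suc m)
      then show ?case using step[of "n + m" i] by (simp add: power_add algebra_simps)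
    qed simp
    have B: "0 \<le> B" using bound[OF x0] abs_ge_zero order_trans by blast
    have "(\<Sum>k<m. q ^ k) \<le> 1 / (1 - q)" for m
      using q sum_gp_strict[of q m] by (simp add: divide_right_mono)
    then have "\<bar>W (n + m) i - W n i\<bar> \<le> q ^ n * (2 * B) * (1 / (1 - q))" for m
      using part[of m] q B by (intro order_trans[OF part] mult_left_mono) auto
    moreover have "(\<lambda>m. \<bar>W (n + m) i - W n i\<bar>) \<longlonglongrightarrow> \<bar>w i - W n i\<bar>"
      using w[of i, THEN LIMSEQ_ignore_initial_segment, of n]
      by (intro tendsto_intros) (simp add: add.commute)
    ultimately show ?thesis by (intro LIMSEQ_le_const2) auto
  qed
  have "F w = w"
  proof
    fix i
    have "(\<lambda>n. F w i - W (Suc n) i) \<longlonglongrightarrow> 0"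
    proof (rule Lim_null_comparison)
      show "\<forall>\<^sub>F n in sequentially. norm (F w i - W (Suc n) i) \<le> q * (q ^ n * (2 * B) / (1 - q))"
        unfolding W_Suc using contr[OF wX WX tail] by (intro always_eventually) auto
      have "(\<lambda>n. q * (q ^ n * (2 * B) / (1 - q))) \<longlonglongrightarrow> q * (0 * (2 * B) / (1 - q))"
        using q by (intro tendsto_intros LIMSEQ_power_zero) auto
      then show "(\<lambda>n. q * (q ^ n * (2 * B) / (1 - q))) \<longlonglongrightarrow> 0" by simp
    qed
    moreover have "(\<lambda>n. F w i - W (Suc n) i) \<longlonglongrightarrow> F w i - w i"
      using LIMSEQ_Suc[OF w] by (intro tendsto_intros)
    ultimately have "F w i - w i = 0" by (rule LIMSEQ_unique[rotated])
    then show "F w i = w i" by simp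
  qed
  then show ?thesis using wX by auto
qed

section \<open>Periodic vectors and the discrete convolution\<close>

lemma per_vec_add_mult:
  assumes "per_vec N v"
  shows "v (i + k * (2 * int N)) = v i"
proof (induction k rule: int_induct[where k = 0])
  case (step1 k)
  have "v (i + k * (2 * int N) + 2 * int N) = v (i + k * (2 * int N))"
    using assms unfolding per_vec_def by blast
  then show ?case using step1 by (simp add: algebra_simps)
next
  case (step2 k)
  have "v (i + (k - 1) * (2 * int N) + 2 * int N) = v (i + (k - 1) * (2 * int N))"
    using assms unfolding per_vec_def by blast
  then show ?case using step2 by (simp add: algebra_simps)
qed simp

lemma per_vec_mod: "per_vec N v \<Longrightarrow> v (i mod (2 * int N)) = v i"
  using per_vec_add_mult[of N v "i mod (2 * int N)" "i div (2 * int N)"] by (simp only: mod_div_mult_eq)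

lemma sum_per_vec_shift:
  assumes "per_vec N v"
  shows "(\<Sum>i\<in>{0..<2 * int N}. v (i + m)) = (\<Sum>i\<in>{0..<2 * int N}. v i)"
proof (cases "N = 0")
  case False
  then show ?thesis
    by (intro sum.reindex_bij_witness[where j = "\<lambda>i. (i + m) mod (2 * int N)" and i = "\<lambda>i. (i - m) mod (2 * int N)"])
      (auto simp: per_vec_mod[OF assms] mod_simps)
qed simp

lemma per_vec_comp: "per_vec N v \<Longrightarrow> per_vec N (\<lambda>i. h (v i))"
  by (simp add: per_vec_def)

lemma per_vec_comp2: "per_vec N v \<Longrightarrow> per_vec N w \<Longrightarrow> per_vec N (\<lambda>i. h (v i) (w i))"
  by (simp add: per_vec_def)

lemma per_vec_shift: "per_vec N v \<Longrightarrow> per_vec N (\<lambda>i. v (i + m))"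
proof -
  assume "per_vec N v"
  then have "v (i + m + 2 * int N) = v (i + m)" for i unfolding per_vec_def by blast
  then show ?thesis by (simp add: per_vec_def add.assoc add.commute add.left_commute)
qed

lemma per_vec_bound:
  assumes "per_vec N v" "N > 0" "\<And>i. i \<in> {0..<2 * int N} \<Longrightarrow> Q (v i)"
  shows "Q (v i)"
  using assms(3)[of "i mod (2 * int N)"] assms(2) per_vec_mod[OF assms(1), of i] by simp

lemma pos_part_nonneg: "0 \<le> pos_part a" and neg_part_nonneg: "0 \<le> neg_part a"
  and pos_part_minus_neg_part: "pos_part a - neg_part a = a"
  by (simp_all add: pos_part_def neg_part_def field_simps)

text \<open>The upwind flux is Lipschitz in the velocity: in terms of half differences and half sums
  the constant is \<open>|x - y| / 2 + |x + y| / 2\<close>, the larger of \<open>|x|\<close> and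
  \<open>|y|\<close>.\<close>

lemma pos_part_neg_part_lipschitz:
  assumes "\<bar>x\<bar> \<le> X" "\<bar>y\<bar> \<le> X"
  shows "\<bar>(pos_part a * x - neg_part a * y) - (pos_part b * x - neg_part b * y)\<bar> \<le> \<bar>a - b\<bar> * X"
proof -
  have "(pos_part a * x - neg_part a * y) - (pos_part b * x - neg_part b * y)
     = (\<bar>a\<bar> - \<bar>b\<bar>) * ((x - y) / 2) + (a - b) * ((x + y) / 2)"
    by (simp add: pos_part_def neg_part_def field_simps)
  also have "\<bar>\<dots>\<bar> \<le> \<bar>a - b\<bar> * \<bar>(x - y) / 2\<bar> + \<bar>a - b\<bar> * \<bar>(x + y) / 2\<bar>"
    by (rule order_trans[OF abs_triangle_ineq])
       (auto simp only: abs_mult intro!: add_mono mult_right_mono abs_triangle_ineq3 abs_ge_zero order_refl)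
  also have "\<dots> = \<bar>a - b\<bar> * (\<bar>(x - y) / 2\<bar> + \<bar>(x + y) / 2\<bar>)" by (simp only: distrib_left)
  also have "\<dots> \<le> \<bar>a - b\<bar> * X"
    using assms by (intro mult_left_mono) (auto simp: abs_if field_simps split: if_splits)
  finally show ?thesis .
qed

lemma theta_per: "per_vec N v \<Longrightarrow> per_vec N (theta P N v)"
  using per_vec_comp2[OF per_vec_shift[of N v 1], of v "\<lambda>a b. (a - b) / mesh P N"]
  by (simp add: theta_def[abs_def])

lemma lam_diff: "lam P K M N (\<lambda>i. v i - w i) i = lam P K M N v i - lam P K M N w i"
  by (simp add: lam_def right_diff_distrib sum_subtractf)

lemma lam_cmult: "lam P K M N (\<lambda>i. a * v i) i = a * lam P K M N v i"
  by (simp add: lam_def sum_distrib_left mult_ac)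

lemma lam_shift: "lam P K M N v (i + 1) = lam P K M N (\<lambda>i. v (i + 1)) i"
  by (simp add: lam_def algebra_simps)

lemma lam_per: "per_vec N v \<Longrightarrow> per_vec N (lam P K M N v)"
proof -
  assume "per_vec N v"
  then have "v (i - j + 2 * int N) = v (i - j)" for i j unfolding per_vec_def by blast
  then show ?thesis by (simp add: per_vec_def lam_def add_diff_eq[symmetric] diff_add_eq)
qed

text \<open>Applied to the slopes, whose sum over a period is 0, so that the constant
  \<open>L\<close> contributes nothing to the entropy dissipation.\<close>

lemma sum_lam:
  assumes "per_vec N v"
  shows "(\<Sum>i\<in>{0..<2 * int N}. lam P K M N v i)
    = (\<Sum>j\<in>{0..<2 * int N}. mesh P N * sigma_PM P K M (of_int j * mesh P N)) * (\<Sum>i\<in>{0..<2 * int N}. v i)"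
proof -
  have "(\<Sum>i\<in>{0..<2 * int N}. v (i - j)) = (\<Sum>i\<in>{0..<2 * int N}. v i)" for j
    using sum_per_vec_shift[OF assms, of "- j"] by simp
  moreover have "(\<Sum>i\<in>{0..<2 * int N}. lam P K M N v i) = (\<Sum>j\<in>{0..<2 * int N}.
      mesh P N * sigma_PM P K M (of_int j * mesh P N) * (\<Sum>i\<in>{0..<2 * int N}. v (i - j)))"
    unfolding lam_def by (subst sum.swap) (simp only: sum_distrib_left)
  ultimately show ?thesis by (simp only: sum_distrib_right)
qed

section \<open>Tangent inequalities for the entropies\<close>

lemma xlnx_tangent:
  fixes x y :: real
  assumes "0 \<le> x" "0 < y"
  shows "y * ln y + (1 + ln y) * (x - y) \<le> x * ln x"
proof (cases "x = 0")
  case False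
  then have x: "x > 0" using assms by simp
  \<comment> \<open>Up to the factor \<open>x\<close> this is the tangent inequality. The case
    \<open>x = 0\<close> is settled by the convention \<open>0 * ln 0 = 0\<close>.\<close>
  have "ln (y / x) \<le> y / x - 1" using x assms by (intro ln_le_minus_one) auto
  then have "x * (ln y - ln x) \<le> x * (y / x - 1)"
    using x assms by (intro mult_left_mono) (auto simp: ln_div)
  then show ?thesis using x by (simp add: algebra_simps)
qed (use assms in \<open>simp add: algebra_simps\<close>)

text \<open>The tangent of \<open>x * ln x\<close> at \<open>1 / exp 1\<close> is horizontal with
  value \<open>- 1 / exp 1\<close>, so the right side is nonnegative.\<close>

lemma entropy_f_le_xlnx:
  assumes "0 \<le> x"
  shows "entropy_f x \<le> x * ln x + 1 / exp 1"
  using xlnx_tangent[OF assms, of "1 / exp 1"] by (auto simp: entropy_f_def ln_div)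

lemma xlnx_le_entropy_f:
  assumes "0 \<le> x" "1 \<le> L"
  shows "x * ln x + 1 / exp 1 \<le> entropy_f x + \<bar>x - L\<bar>"
proof (cases "1 / exp 1 \<le> x")
  case False
  \<comment> \<open>The crude bound is enough: \<open>x < 1 / 2\<close> and \<open>L \<ge> 1\<close>
    give \<open>|x - L| \<ge> 1 / 2 \<ge> 1 / exp 1\<close>.\<close>
  have "(2 :: real) \<le> exp 1" using exp_ge_add_one_self[of 1] by simp
  then have e: "1 / exp 1 \<le> (1 / 2 :: real)" by (simp add: field_simps)
  have "x * ln x \<le> 0"
  proof (cases "x = 0")
    case x: False
    have "x \<le> 1" using False e by linarith
    then show ?thesis using x assms by (intro mult_nonneg_nonpos) auto
  qed simp
  moreover have "1 / exp 1 \<le> \<bar>x - L\<bar>" using False e assms(2) by linarith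
  ultimately show ?thesis using False by (simp add: entropy_f_def)
qed (simp add: entropy_f_def)

text \<open>The two branches of \<open>entropy_f\<close> meet at \<open>1 / exp 1\<close> with slope
  0 on both sides, so it is convex and continuously differentiable. In the mixed cases the branch
  point takes the place of the argument below it.\<close>

lemma entropy_f_tangent:
  assumes "0 \<le> x" "0 \<le> y"
  shows "entropy_f y + (if y \<ge> 1 / exp 1 then ln y + 1 else 0) * (x - y) \<le> entropy_f x"
proof -
  define e :: real where "e = 1 / exp 1"
  have e: "0 < e" "ln e = - 1" by (simp_all add: e_def ln_div)
  consider "e \<le> y" "e \<le> x" | "e \<le> y" "x < e" | "y < e" "e \<le> x" | "y < e" "x < e" by linarith
  then show ?thesis
  proof cases
    case 1
    then show ?thesis using xlnx_tangent[of x y] e by (simp add: entropy_f_def e_def[symmetric] algebra_simps)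
  next
    case 2
    have "ln e \<le> ln y" by (subst ln_le_cancel_iff) (use 2 e in auto)
    then have "- 1 \<le> ln y" unfolding e(2) .
    then have "(ln y + 1) * (x - y) \<le> (ln y + 1) * (e - y)"
      using 2 e by (intro mult_left_mono) auto
    then show ?thesis using 2 e xlnx_tangent[of e y] by (simp add: entropy_f_def e_def[symmetric] algebra_simps)
  next
    case 3
    then show ?thesis using xlnx_tangent[of x e] e by (simp add: entropy_f_def e_def[symmetric] algebra_simps)
  next
    case 4
    then show ?thesis by (simp add: entropy_f_def e_def[symmetric])
  qed
qed

text \<open>\<open>S\<close> bounds the discrete norm of the kernel and will be
  \<open>4 * \<kappa>\<close>. The step-size conditions then yield \<open>4 / 30 = 2 / 15\<close>
  for \<open>cfl\<close> and \<open>4 / 10 = 2 / 5\<close> for \<open>dt_bound\<close>.\<close>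

locale scheme =
  fixes P :: real and K :: "real \<Rightarrow> real" and M N :: nat and L dt S A :: real
  assumes P_pos: "P > 0" and N_pos: "N > 0" and dt_pos: "dt > 0"
    and L_nonneg: "0 \<le> L" and S_nonneg: "0 \<le> S" and A_nonneg: "0 \<le> A"
    and sum_sigma: "(\<Sum>j\<in>{0..<2 * int N}. mesh P N * \<bar>sigma_PM P K M (of_int j * mesh P N)\<bar>) \<le> S"
    and lam_negative_type: "\<And>v. per_vec N v \<Longrightarrow> (\<Sum>i\<in>{0..<2 * int N}. v i * lam P K M N v i) \<le> 0"
    and cfl: "dt / mesh P N * (S * A) \<le> 2 / 15"
    and dt_bound: "dt * (L * S) \<le> 2 / 5"
begin

abbreviation "I \<equiv> {0..<2 * int N}"
abbreviation "\<Lambda> \<equiv> lam P K M N"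
definition r :: real where "r = dt / mesh P N"
abbreviation "\<rho> v i \<equiv> theta P N v i + L"

text \<open>One implicit step is a fixed point of \<open>update v\<close>: the differences are those
  of the old vector, and only the velocity depends on the new one.\<close>

definition update :: "(int \<Rightarrow> real) \<Rightarrow> (int \<Rightarrow> real) \<Rightarrow> int \<Rightarrow> real" where
  "update v w i = v i + dt * (pos_part (\<Lambda> w i) * theta P N v i - neg_part (\<Lambda> w i) * theta P N v (i - 1) + L * \<Lambda> w i)"

lemma mesh_pos: "mesh P N > 0" and r_pos: "r > 0"
  using P_pos N_pos dt_pos by (simp_all add: mesh_def r_def)

lemma mesh_r: "mesh P N * r = dt" "mesh P N * (r * x) = dt * x"
  using mesh_pos by (simp_all add: r_def)

lemma scheme_step_iff: "scheme_step P K M N L dt v w \<longleftrightarrow> update v w = w"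
  using dt_pos unfolding scheme_step_def update_def fun_eq_iff
  by (intro all_cong1) (auto simp: field_simps)

lemma lam_abs_le:
  assumes "\<And>i. \<bar>v i\<bar> \<le> B"
  shows "\<bar>\<Lambda> v i\<bar> \<le> S * B"
proof -
  have "\<bar>\<Lambda> v i\<bar> \<le> (\<Sum>j\<in>I. \<bar>mesh P N * sigma_PM P K M (of_int j * mesh P N) * v (i - j)\<bar>)"
    unfolding lam_def by (rule sum_abs)
  also have "\<dots> \<le> (\<Sum>j\<in>I. mesh P N * \<bar>sigma_PM P K M (of_int j * mesh P N)\<bar> * B)"
    using mesh_pos by (intro sum_mono) (auto simp: abs_mult intro!: mult_left_mono assms)
  also have "\<dots> \<le> S * B"
    unfolding sum_distrib_right[symmetric]
    using sum_sigma order_trans[OF abs_ge_zero assms] by (rule mult_right_mono)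
  finally show ?thesis .
qed

lemma sum_abs_lam_le:
  assumes "per_vec N v"
  shows "(\<Sum>i\<in>I. \<bar>\<Lambda> v i\<bar>) \<le> S * (\<Sum>i\<in>I. \<bar>v i\<bar>)"
proof -
  have shift: "(\<Sum>i\<in>I. \<bar>v (i - j)\<bar>) = (\<Sum>i\<in>I. \<bar>v i\<bar>)" for j
    using sum_per_vec_shift[OF per_vec_comp[OF assms, of abs], of "- j"] by simp
  have "(\<Sum>i\<in>I. \<bar>\<Lambda> v i\<bar>) \<le> (\<Sum>i\<in>I. \<Sum>j\<in>I. mesh P N * \<bar>sigma_PM P K M (of_int j * mesh P N)\<bar> * \<bar>v (i - j)\<bar>)"
    unfolding lam_def using mesh_pos
    by (intro sum_mono order_trans[OF sum_abs]) (auto simp: abs_mult)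
  also have "\<dots> = (\<Sum>j\<in>I. mesh P N * \<bar>sigma_PM P K M (of_int j * mesh P N)\<bar> * (\<Sum>i\<in>I. \<bar>v (i - j)\<bar>))"
    by (subst sum.swap) (simp only: sum_distrib_left)
  also have "\<dots> = (\<Sum>j\<in>I. mesh P N * \<bar>sigma_PM P K M (of_int j * mesh P N)\<bar>) * (\<Sum>i\<in>I. \<bar>v i\<bar>)"
    by (simp only: shift sum_distrib_right)
  also have "\<dots> \<le> S * (\<Sum>i\<in>I. \<bar>v i\<bar>)"
    using sum_sigma by (rule mult_right_mono) (auto intro: sum_nonneg)
  finally show ?thesis .
qed

lemma r_lam_abs_le:
  assumes "\<And>i. \<bar>w i\<bar> \<le> A"
  shows "r * \<bar>\<Lambda> w i\<bar> \<le> 2 / 15"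
  using mult_left_mono[OF lam_abs_le[of w A i, OF assms] less_imp_le[OF r_pos]] cfl
  unfolding r_def by linarith

lemma r_pos_part_le:
  assumes "\<And>i. \<bar>w i\<bar> \<le> A"
  shows "r * pos_part (\<Lambda> w i) \<le> 2 / 15" "r * neg_part (\<Lambda> w i) \<le> 2 / 15"
proof -
  have "pos_part (\<Lambda> w i) \<le> \<bar>\<Lambda> w i\<bar>" "neg_part (\<Lambda> w i) \<le> \<bar>\<Lambda> w i\<bar>"
    by (auto simp: pos_part_def neg_part_def)
  then show "r * pos_part (\<Lambda> w i) \<le> 2 / 15" "r * neg_part (\<Lambda> w i) \<le> 2 / 15"
    using r_lam_abs_le[of w i, OF assms] mult_left_mono[OF _ less_imp_le[OF r_pos]] order_trans by meson+
qed

lemma update_eq_convex: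
  "update v w i = (1 - r * pos_part (\<Lambda> w i) - r * neg_part (\<Lambda> w i)) * v i
     + r * pos_part (\<Lambda> w i) * v (i + 1) + r * neg_part (\<Lambda> w i) * v (i - 1) + dt * (L * \<Lambda> w i)"
proof -
  have "dt * theta P N v i = r * (v (i + 1) - v i)" for i
    by (simp add: theta_def r_def)
  from this[of i] this[of "i - 1"]
  have "dt * (a * theta P N v i) = a * (r * (v (i + 1) - v i))"
    "dt * (a * theta P N v (i - 1)) = a * (r * (v i - v (i - 1)))" for a
    by (simp_all only: mult.left_commute[of dt] diff_add_cancel)
  then show ?thesis
    unfolding update_def by (simp only: distrib_left right_diff_distrib) (simp add: algebra_simps)
qed

text \<open>By the CFL bound the first three terms of \<open>update_eq_convex\<close> form a convex
  combination of old values; only the source term can raise the maximum.\<close>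

lemma update_abs_le:
  assumes v: "\<And>i. \<bar>v i\<bar> \<le> B" and w: "\<And>i. \<bar>w i\<bar> \<le> C" and "C \<le> A"
  shows "\<bar>update v w i\<bar> \<le> B + dt * (L * S) * C"
proof -
  let ?a = "r * pos_part (\<Lambda> w i)" and ?b = "r * neg_part (\<Lambda> w i)"
  have wA: "\<bar>w i\<bar> \<le> A" for i using w[of i] \<open>C \<le> A\<close> by linarith
  have nn: "0 \<le> ?a" "0 \<le> ?b" "0 \<le> 1 - ?a - ?b"
    using r_pos r_pos_part_le[of w i, OF wA] by (auto simp: pos_part_nonneg neg_part_nonneg intro!: mult_nonneg_nonneg)
  have "\<bar>update v w i\<bar> \<le> \<bar>(1 - ?a - ?b) * v i\<bar> + \<bar>?a * v (i + 1)\<bar> + \<bar>?b * v (i - 1)\<bar> + \<bar>dt * (L * \<Lambda> w i)\<bar>"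
    unfolding update_eq_convex by linarith
  also have "\<dots> = (1 - ?a - ?b) * \<bar>v i\<bar> + ?a * \<bar>v (i + 1)\<bar> + ?b * \<bar>v (i - 1)\<bar> + dt * (L * \<bar>\<Lambda> w i\<bar>)"
    unfolding abs_mult[of "1 - ?a - ?b"] abs_mult[of ?a "v (i + 1)"] abs_mult[of ?b "v (i - 1)"]
      abs_mult[of dt] abs_mult[of L]
    using nn dt_pos L_nonneg by (simp only: abs_of_nonneg abs_of_pos)
  also have "\<dots> \<le> (1 - ?a - ?b) * B + ?a * B + ?b * B + dt * (L * (S * C))"
    using nn dt_pos L_nonneg by (intro add_mono mult_left_mono v lam_abs_le w) auto
  also have "\<dots> = B + dt * (L * S) * C" by (simp add: algebra_simps)
  finally show ?thesis .
qed

text \<open>The slopes of \<open>v\<close> are at most \<open>2 * A / mesh P N\<close> and the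
  velocities differ by at most \<open>S * D\<close>, so the factor is
  \<open>2 * (2 / 15) + 2 / 5 = 2 / 3\<close>.\<close>

lemma update_contraction:
  assumes v: "\<And>i. \<bar>v i\<bar> \<le> A" and D: "\<And>i. \<bar>w i - w' i\<bar> \<le> D"
  shows "\<bar>update v w i - update v w' i\<bar> \<le> 2 / 3 * D"
proof -
  let ?X = "2 * A / mesh P N"
  have th: "\<bar>theta P N v i\<bar> \<le> ?X" for i
  proof -
    have "\<bar>v (i + 1) - v i\<bar> \<le> 2 * A" using v[of "i + 1"] v[of i] by linarith
    then show ?thesis using mesh_pos by (simp add: theta_def abs_divide divide_right_mono)
  qed
  have D0: "0 \<le> D" using D abs_ge_zero order_trans by blast
  let ?d = "\<bar>\<Lambda> w i - \<Lambda> w' i\<bar>"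
  have lam: "?d \<le> S * D"
    using lam_abs_le[of "\<lambda>i. w i - w' i" D i] D by (simp add: lam_diff)
  let ?d1 = "(pos_part (\<Lambda> w i) * theta P N v i - neg_part (\<Lambda> w i) * theta P N v (i - 1))
      - (pos_part (\<Lambda> w' i) * theta P N v i - neg_part (\<Lambda> w' i) * theta P N v (i - 1))"
  have "\<bar>?d1 + L * (\<Lambda> w i - \<Lambda> w' i)\<bar> \<le> \<bar>?d1\<bar> + L * ?d"
    using L_nonneg by (rule_tac order_trans[OF abs_triangle_ineq]) (simp add: abs_mult)
  also have "\<dots> \<le> ?d * ?X + L * ?d"
    by (rule add_right_mono, rule pos_part_neg_part_lipschitz) (rule th)+
  finally have d1: "\<bar>?d1 + L * (\<Lambda> w i - \<Lambda> w' i)\<bar> \<le> ?d * ?X + L * ?d" .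
  have "update v w i - update v w' i = dt * (?d1 + L * (\<Lambda> w i - \<Lambda> w' i))"
    by (simp add: update_def algebra_simps)
  then have "\<bar>update v w i - update v w' i\<bar> = dt * \<bar>?d1 + L * (\<Lambda> w i - \<Lambda> w' i)\<bar>"
    by (simp only: abs_mult abs_of_pos[OF dt_pos])
  also have "\<dots> \<le> dt * (?d * ?X + L * ?d)"
    using d1 dt_pos by (intro mult_left_mono) auto
  also have "\<dots> = dt * (?X + L) * ?d" by (simp add: algebra_simps)
  also have "\<dots> \<le> dt * (?X + L) * (S * D)"
    using dt_pos L_nonneg A_nonneg mesh_pos by (intro mult_left_mono lam) auto
  also have "\<dots> = (2 * (r * (S * A)) + dt * (L * S)) * D"
    by (simp add: r_def field_simps)
  also have "\<dots> \<le> 2 / 3 * D"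
    using cfl dt_bound D0 unfolding r_def by (intro mult_right_mono) linarith+
  finally show ?thesis .
qed

lemma update_per: "per_vec N v \<Longrightarrow> per_vec N w \<Longrightarrow> per_vec N (update v w)"
proof -
  assume "per_vec N v" "per_vec N w"
  then have "per_vec N v" "per_vec N (theta P N v)" "per_vec N (\<Lambda> w)" "per_vec N (\<lambda>i. theta P N v (i + - 1))"
    by (simp_all only: theta_per lam_per per_vec_shift)
  then show ?thesis by (simp add: per_vec_def update_def)
qed

text \<open>For \<open>S = 4 * \<kappa>\<close> this is \<open>exp (10 * L * \<kappa> * dt)\<close>,
  whose power over all time steps is the factor \<open>exp (10 * L * T * \<kappa>)\<close> of the a
  priori bounds.\<close>

definition growth :: real where "growth = exp (5 / 2 * (dt * (L * S)))"

lemma growth_ge_1: "1 \<le> growth"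
  unfolding growth_def using dt_pos L_nonneg S_nonneg by auto

lemma growth_bound: "1 \<le> (1 - dt * (L * S)) * growth"
proof -
  define y where "y = dt * (L * S)"
  have y: "0 \<le> y" "y \<le> 2 / 5" using dt_bound dt_pos L_nonneg S_nonneg by (auto simp: y_def)
  \<comment> \<open>This product is the excess of \<open>(1 - y) * (1 + 5 / 2 * y)\<close> over 1;
    its second factor is at least \<open>1 / 2\<close> for \<open>y \<le> 2 / 5\<close>.\<close>
  have "0 \<le> y * (3 / 2 - 5 / 2 * y)" using y by (intro mult_nonneg_nonneg) auto
  then have "1 \<le> (1 - y) * (1 + 5 / 2 * y)" by (simp add: algebra_simps)
  also have "\<dots> \<le> (1 - y) * exp (5 / 2 * y)"
    using y exp_ge_add_one_self[of "5 / 2 * y"] by (intro mult_left_mono) auto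
  finally show ?thesis by (simp add: growth_def y_def)
qed

lemma implicit_growth:
  assumes "a \<le> b + dt * (L * S) * a" "0 \<le> b"
  shows "a \<le> b * growth"
proof -
  have "(1 - dt * (L * S)) * a \<le> b" using assms by (simp add: algebra_simps)
  also have "b \<le> b * ((1 - dt * (L * S)) * growth)"
    using mult_left_mono[OF growth_bound assms(2)] by simp
  also have "\<dots> = (1 - dt * (L * S)) * (b * growth)" by simp
  finally show ?thesis using dt_bound by (simp add: mult_le_cancel_left)
qed

lemma step_unique:
  assumes "\<And>i. \<bar>v i\<bar> \<le> A" "\<And>i. \<bar>w i\<bar> \<le> A" "\<And>i. \<bar>w' i\<bar> \<le> A"
    "update v w = w" "update v w' = w'"
  shows "w = w'"
proof (rule contraction_fixpoint_unique[where F = "update v" and q = "2 / 3" and B = "2 * A"])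
  show "\<bar>update v w i - update v w' i\<bar> \<le> 2 / 3 * D" if "\<And>j. \<bar>w j - w' j\<bar> \<le> D" for D i
    using assms(1) that by (rule update_contraction)
  show "\<bar>w i - w' i\<bar> \<le> 2 * A" for i using assms(2)[of i] assms(3)[of i] by linarith
qed (use assms in auto)

text \<open>The ball of radius \<open>B * growth\<close> in the periodic vectors is invariant: the
  new bound is \<open>B * (1 + dt * (L * S) * growth)\<close>, and \<open>growth_bound\<close> says
  that this is at most \<open>B * growth\<close>.\<close>

lemma step_exists:
  assumes v: "per_vec N v" "\<And>i. \<bar>v i\<bar> \<le> B" and B: "B * growth \<le> A"
  shows "\<exists>w. per_vec N w \<and> (\<forall>i. \<bar>w i\<bar> \<le> B * growth) \<and> update v w = w"
proof -
  let ?X = "{w. per_vec N w \<and> (\<forall>i. \<bar>w i\<bar> \<le> B * growth)}"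
  have B0: "0 \<le> B" using v(2) abs_ge_zero order_trans by blast
  have "B * 1 \<le> B * growth" using B0 growth_ge_1 by (intro mult_left_mono)
  then have vA: "\<bar>v i\<bar> \<le> A" for i using v(2)[of i] B by linarith
  have "\<exists>w\<in>?X. update v w = w"
  proof (rule contraction_fixpoint_exists[where q = "2 / 3" and B = "B * growth" and ?x0.0 = "\<lambda>_. 0"])
    show "\<bar>update v x i - update v y i\<bar> \<le> 2 / 3 * D" if "\<And>j. \<bar>x j - y j\<bar> \<le> D" for x y D i
      using vA that by (rule update_contraction)
    show "x \<in> ?X" if f: "\<And>n. f n \<in> ?X" and lim: "\<And>i. (\<lambda>n. f n i) \<longlonglongrightarrow> x i" for f x
    proof -
      have "x (i + 2 * int N) = x i" for i
        using lim[of i] lim[of "i + 2 * int N"] f by (intro LIMSEQ_unique[of "\<lambda>n. f n i"]) (auto simp: per_vec_def)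
      moreover have "\<bar>x i\<bar> \<le> B * growth" for i
        using f tendsto_rabs[OF lim[of i]] by (intro LIMSEQ_le_const2[of "\<lambda>n. \<bar>f n i\<bar>"]) auto
      ultimately show ?thesis by (simp add: per_vec_def)
    qed
    show "(\<lambda>_. 0) \<in> ?X" using B0 growth_ge_1 by (simp add: per_vec_def)
    show "update v x \<in> ?X" if x: "x \<in> ?X" for x
    proof -
      have "\<bar>update v x i\<bar> \<le> B * growth" for i
      proof -
        have "\<bar>update v x i\<bar> \<le> B + dt * (L * S) * (B * growth)"
          using x by (intro update_abs_le v(2) B) auto
        also have "\<dots> = B * (1 + dt * (L * S) * growth)" by (simp add: algebra_simps)
        also have "\<dots> \<le> B * growth"
          using growth_bound B0 by (intro mult_left_mono) (auto simp: algebra_simps)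
        finally show ?thesis .
      qed
      then show ?thesis using x v(1) by (auto intro: update_per)
    qed
  qed auto
  then show ?thesis by blast
qed

section \<open>The scheme for the slopes as a transport\<close>

lemma TV_vec_eq: "TV_vec N u = mesh P N * (\<Sum>i\<in>I. \<bar>theta P N u i\<bar>)"
  using mesh_pos by (simp add: TV_vec_def theta_def sum_distrib_left abs_divide)

text \<open>Conservative upwind form: \<open>l i\<close> sits at the interface of the cells
  \<open>i - 1\<close> and \<open>i\<close>, and its positive part moves mass from \<open>i\<close>
  to \<open>i - 1\<close>.\<close>

definition transport :: "(int \<Rightarrow> real) \<Rightarrow> (int \<Rightarrow> real) \<Rightarrow> int \<Rightarrow> real" where
  "transport l g i = (1 - r * neg_part (l (i + 1)) - r * pos_part (l i)) * g i
     + r * pos_part (l (i + 1)) * g (i + 1) + r * neg_part (l i) * g (i - 1)"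

text \<open>Conservation of mass: what a cell loses its two neighbours gain, which after an index
  shift is a cancellation for each of the two signs.\<close>

lemma sum_transport:
  assumes "per_vec N l" "per_vec N g"
  shows "(\<Sum>i\<in>I. transport l g i) = (\<Sum>i\<in>I. g i)"
proof -
  have 1: "(\<Sum>i\<in>I. r * (pos_part (l (i + 1)) * g (i + 1))) = (\<Sum>i\<in>I. r * (pos_part (l i) * g i))"
    by (rule sum_per_vec_shift[where v = "\<lambda>i. r * (pos_part (l i) * g i)"]) (use assms in \<open>simp add: per_vec_def\<close>)
  have "per_vec N (\<lambda>i. g (i + - 1))" by (rule per_vec_shift[OF assms(2)])
  then have "(\<Sum>i\<in>I. r * (neg_part (l (i + 1)) * g (i + 1 - 1))) = (\<Sum>i\<in>I. r * (neg_part (l i) * g (i - 1)))"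
    by (intro sum_per_vec_shift[where v = "\<lambda>i. r * (neg_part (l i) * g (i - 1))"]) (use assms in \<open>simp add: per_vec_def\<close>)
  then have 2: "(\<Sum>i\<in>I. r * (neg_part (l (i + 1)) * g i)) = (\<Sum>i\<in>I. r * (neg_part (l i) * g (i - 1)))"
    by simp
  have "transport l g i = g i - r * (neg_part (l (i + 1)) * g i) - r * (pos_part (l i) * g i)
     + r * (pos_part (l (i + 1)) * g (i + 1)) + r * (neg_part (l i) * g (i - 1))" for i
    by (simp add: transport_def left_diff_distrib mult.assoc)
  then show ?thesis
    using 1 2 by (simp only: sum.distrib sum_subtractf)
qed

text \<open>Constants are multiplied by the row sum, through which the discrete divergence of the
  velocity enters.\<close>

lemma transport_linear:
  "transport l (\<lambda>i. a * g i + b) i = a * transport l g i + b * (1 + r * (l (i + 1) - l i))"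
proof -
  have "l (i + 1) - l i = (pos_part (l (i + 1)) - neg_part (l (i + 1))) - (pos_part (l i) - neg_part (l i))"
    by (simp only: pos_part_minus_neg_part)
  then show ?thesis unfolding transport_def by (simp only:) (simp add: algebra_simps)
qed

end

section \<open>Variation and entropy over one step\<close>

locale scheme_solution = scheme +
  fixes v w :: "int \<Rightarrow> real"
  assumes v_per: "per_vec N v" and w_per: "per_vec N w"
    and w_bound: "\<And>i. \<bar>w i\<bar> \<le> A"
    and w_eq: "update v w = w"
    and \<rho>_nonneg: "\<And>i. 0 \<le> \<rho> v i"
begin

lemma theta_step:
  "theta P N w i = transport (\<Lambda> w) (theta P N v) i + r * L * (\<Lambda> w (i + 1) - \<Lambda> w i)"
proof -
  have *: "w i = v i + dt * (pos_part (\<Lambda> w i) * theta P N v i - neg_part (\<Lambda> w i) * theta P N v (i - 1) + L * \<Lambda> w i)" for i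
    using w_eq by (metis update_def)
  have "v (i + 1) - v i = mesh P N * theta P N v i"
    using mesh_pos by (simp add: theta_def)
  then have "w (i + 1) - w i = mesh P N * theta P N v i
      + dt * (pos_part (\<Lambda> w (i + 1)) * theta P N v (i + 1) - neg_part (\<Lambda> w (i + 1)) * theta P N v i + L * \<Lambda> w (i + 1))
      - dt * (pos_part (\<Lambda> w i) * theta P N v i - neg_part (\<Lambda> w i) * theta P N v (i - 1) + L * \<Lambda> w i)"
    using *[of i] *[of "i + 1"] by simp
  also have "\<dots> = mesh P N * (transport (\<Lambda> w) (theta P N v) i + r * L * (\<Lambda> w (i + 1) - \<Lambda> w i))"
  proof -
    have "m * t + d * (p1 * t1 - n1 * t + L * l1) - d * (p * t - n * t0 + L * l)
        = m * ((1 - k * n1 - k * p) * t + k * p1 * t1 + k * n * t0 + k * L * (l1 - l))"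
      if "m * k = d" for m t d k p1 t1 n1 l1 p n t0 l :: real
      unfolding that[symmetric] by (simp add: algebra_simps)
    then show ?thesis unfolding transport_def using mesh_r(1) .
  qed
  finally show ?thesis
    using mesh_pos by (simp add: theta_def[of P N w])
qed

text \<open>The source term in \<open>theta_step\<close> is exactly the excess of the transported
  constant \<open>L\<close> over \<open>L\<close>, so adding \<open>L\<close> makes the equation
  homogeneous.\<close>

lemma \<rho>_step: "\<rho> w i = transport (\<Lambda> w) (\<rho> v) i"
  using theta_step[of i] transport_linear[of "\<Lambda> w" 1 "theta P N v" L i] by (simp add: algebra_simps)

text \<open>All weights are nonnegative, since each outflow takes at most the fraction
  \<open>2 / 15\<close>.\<close>

lemma transport_mono:
  assumes "\<And>i. g i \<le> h i"
  shows "transport (\<Lambda> w) g i \<le> transport (\<Lambda> w) h i"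
  unfolding transport_def
  using r_pos r_pos_part_le[of w i, OF w_bound] r_pos_part_le[of w "i + 1", OF w_bound]
  by (intro add_mono mult_left_mono assms) (auto simp: pos_part_nonneg neg_part_nonneg intro!: mult_nonneg_nonneg)

lemma \<rho>_step_nonneg: "0 \<le> \<rho> w i"
  using transport_mono[of "\<lambda>_. 0" "\<rho> v" i] \<rho>_nonneg by (simp add: \<rho>_step transport_def[of _ "\<lambda>_. 0"])

lemma lam_increment: "\<Lambda> w (i + 1) - \<Lambda> w i = mesh P N * \<Lambda> (theta P N w) i"
proof -
  have "\<Lambda> w (i + 1) - \<Lambda> w i = \<Lambda> (\<lambda>i. w (i + 1) - w i) i"
    unfolding lam_shift lam_diff ..
  also have "(\<lambda>i. w (i + 1) - w i) = (\<lambda>i. mesh P N * theta P N w i)"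
    using mesh_pos by (simp add: theta_def)
  finally show ?thesis unfolding lam_cmult .
qed

lemma sum_abs_lam_increment: "(\<Sum>i\<in>I. \<bar>\<Lambda> w (i + 1) - \<Lambda> w i\<bar>) \<le> S * TV_vec N w"
proof -
  have "(\<Sum>i\<in>I. \<bar>\<Lambda> w (i + 1) - \<Lambda> w i\<bar>) = mesh P N * (\<Sum>i\<in>I. \<bar>\<Lambda> (theta P N w) i\<bar>)"
    using mesh_pos by (simp add: lam_increment abs_mult sum_distrib_left)
  also have "\<dots> \<le> mesh P N * (S * (\<Sum>i\<in>I. \<bar>theta P N w i\<bar>))"
    using mesh_pos by (intro mult_left_mono sum_abs_lam_le theta_per w_per) auto
  finally show ?thesis by (simp add: TV_vec_eq mult.left_commute)
qed

text \<open>Transport does not increase the sum of absolute slopes. The source adds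
  \<open>dt * (L * S)\<close> times the new variation, which \<open>implicit_growth\<close> absorbs
  on the left.\<close>

lemma TV_step: "TV_vec N w \<le> TV_vec N v * growth"
proof (rule implicit_growth)
  have "\<bar>theta P N w i\<bar> \<le> transport (\<Lambda> w) (\<lambda>i. \<bar>theta P N v i\<bar>) i + r * L * \<bar>\<Lambda> w (i + 1) - \<Lambda> w i\<bar>" for i
  proof -
    have "transport (\<Lambda> w) (theta P N v) i \<le> transport (\<Lambda> w) (\<lambda>i. \<bar>theta P N v i\<bar>) i"
      by (intro transport_mono) simp
    \<comment> \<open>The integrand is written in the shape of \<open>transport_linear\<close>,
      which extracts the sign.\<close>
    moreover have "transport (\<Lambda> w) (\<lambda>i. - 1 * theta P N v i + 0) i \<le> transport (\<Lambda> w) (\<lambda>i. \<bar>theta P N v i\<bar>) i"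
      by (intro transport_mono) simp
    then have "- transport (\<Lambda> w) (theta P N v) i \<le> transport (\<Lambda> w) (\<lambda>i. \<bar>theta P N v i\<bar>) i"
      unfolding transport_linear by simp
    moreover have "\<bar>r * L * (\<Lambda> w (i + 1) - \<Lambda> w i)\<bar> = r * L * \<bar>\<Lambda> w (i + 1) - \<Lambda> w i\<bar>"
      using L_nonneg r_pos by (simp add: abs_mult)
    ultimately show ?thesis unfolding theta_step by linarith
  qed
  then have "(\<Sum>i\<in>I. \<bar>theta P N w i\<bar>)
      \<le> (\<Sum>i\<in>I. transport (\<Lambda> w) (\<lambda>i. \<bar>theta P N v i\<bar>) i + r * L * \<bar>\<Lambda> w (i + 1) - \<Lambda> w i\<bar>)"
    by (rule sum_mono)
  also have "\<dots> = (\<Sum>i\<in>I. \<bar>theta P N v i\<bar>) + r * L * (\<Sum>i\<in>I. \<bar>\<Lambda> w (i + 1) - \<Lambda> w i\<bar>)"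
    by (simp only: sum.distrib sum_distrib_left
        sum_transport[OF lam_per[OF w_per] per_vec_comp[OF theta_per[OF v_per]]])
  also have "\<dots> \<le> (\<Sum>i\<in>I. \<bar>theta P N v i\<bar>) + r * L * (S * TV_vec N w)"
    using r_pos L_nonneg by (intro add_left_mono mult_left_mono sum_abs_lam_increment) auto
  finally have "mesh P N * (\<Sum>i\<in>I. \<bar>theta P N w i\<bar>)
      \<le> mesh P N * ((\<Sum>i\<in>I. \<bar>theta P N v i\<bar>) + r * L * (S * TV_vec N w))"
    using mesh_pos by (intro mult_left_mono) auto
  also have "\<dots> = mesh P N * (\<Sum>i\<in>I. \<bar>theta P N v i\<bar>) + dt * (L * S) * TV_vec N w"
    by (simp add: distrib_left mesh_r mult.assoc)
  finally show "TV_vec N w \<le> TV_vec N v + dt * (L * S) * TV_vec N w"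
    unfolding TV_vec_eq[symmetric] .
  show "0 \<le> TV_vec N v" by (simp add: TV_vec_def sum_nonneg)
qed

lemma sum_theta_eq_0: "(\<Sum>i\<in>I. theta P N w i) = 0"
  using sum_per_vec_shift[OF w_per, of 1]
  by (simp add: theta_def sum_divide_distrib[symmetric] sum_subtractf)

text \<open>The sign of the kernel enters here: increments of the velocity are the convolution of
  the kernel with the slopes, so the \<open>theta\<close> part is a quadratic form of negative type,
  and the \<open>L\<close> part vanishes because the slopes have sum 0.\<close>

lemma sum_\<rho>_lam_increment: "(\<Sum>i\<in>I. \<rho> w i * (\<Lambda> w (i + 1) - \<Lambda> w i)) \<le> 0"
proof -
  have "(\<Sum>i\<in>I. \<rho> w i * (\<Lambda> w (i + 1) - \<Lambda> w i))
     = mesh P N * ((\<Sum>i\<in>I. theta P N w i * \<Lambda> (theta P N w) i) + L * (\<Sum>i\<in>I. \<Lambda> (theta P N w) i))"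
    by (simp add: lam_increment sum_distrib_left sum.distrib[symmetric] algebra_simps)
  also have "\<dots> \<le> 0"
    using lam_negative_type[OF theta_per[OF w_per]] mesh_pos
    by (simp add: sum_lam[OF theta_per[OF w_per]] sum_theta_eq_0 mult_nonneg_nonpos)
  finally show ?thesis .
qed

text \<open>The tangent to \<open>G\<close> is taken at the new value \<open>\<rho> w i\<close>: the transport weights are
  stochastic only in the column sums, and the row sums \<open>1 + r (\<lambda>\<^sub>i\<^sub>+\<^sub>1 - \<lambda>\<^sub>i)\<close>
  produce the term with \<open>H y = y G'(y) - G y\<close>.\<close>

lemma transport_tangent:
  assumes "\<And>x. 0 \<le> x \<Longrightarrow> G (\<rho> w i) + g * (x - \<rho> w i) \<le> G x"
  shows "G (\<rho> w i) - r * ((\<rho> w i * g - G (\<rho> w i)) * (\<Lambda> w (i + 1) - \<Lambda> w i)) \<le> transport (\<Lambda> w) (\<lambda>i. G (\<rho> v i)) i"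
proof -
  have "transport (\<Lambda> w) (\<lambda>j. g * \<rho> v j + (G (\<rho> w i) - g * \<rho> w i)) i \<le> transport (\<Lambda> w) (\<lambda>i. G (\<rho> v i)) i"
    using assms[OF \<rho>_nonneg] by (intro transport_mono) (simp add: algebra_simps)
  then show ?thesis
    unfolding transport_linear \<rho>_step[symmetric] by (simp add: algebra_simps)
qed

text \<open>Summed over a period, the column sums 1 turn the transported entropy into the old one.
  \<open>G\<close> and \<open>H\<close> are left open to serve both entropies.\<close>

lemma entropy_step:
  assumes "\<And>i. G (\<rho> w i) - r * (H i * (\<Lambda> w (i + 1) - \<Lambda> w i)) \<le> transport (\<Lambda> w) (\<lambda>i. G (\<rho> v i)) i"
  shows "(\<Sum>i\<in>I. G (\<rho> w i)) \<le> (\<Sum>i\<in>I. G (\<rho> v i)) + r * (\<Sum>i\<in>I. H i * (\<Lambda> w (i + 1) - \<Lambda> w i))"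
proof -
  have "(\<Sum>i\<in>I. G (\<rho> w i) - r * (H i * (\<Lambda> w (i + 1) - \<Lambda> w i)))
     \<le> (\<Sum>i\<in>I. transport (\<Lambda> w) (\<lambda>i. G (\<rho> v i)) i)"
    using assms by (rule sum_mono)
  also have "\<dots> = (\<Sum>i\<in>I. G (\<rho> v i))"
    by (rule sum_transport[OF lam_per[OF w_per] per_vec_comp[OF theta_per[OF v_per], where h = "\<lambda>x. G (x + L)"]])
  finally show ?thesis by (simp add: sum_subtractf sum_distrib_left)
qed

lemma xlnx_step: "(\<Sum>i\<in>I. \<rho> w i * ln (\<rho> w i)) \<le> (\<Sum>i\<in>I. \<rho> v i * ln (\<rho> v i))"
proof -
  have "\<rho> w i * ln (\<rho> w i) - r * (\<rho> w i * (\<Lambda> w (i + 1) - \<Lambda> w i))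
      \<le> transport (\<Lambda> w) (\<lambda>i. \<rho> v i * ln (\<rho> v i)) i" for i
  proof (cases "\<rho> w i = 0")
    \<comment> \<open>The tangent at 0 is vertical. However, a vanishing new value forces each
      product of a weight and an old value to vanish, hence also each weight times
      \<open>\<rho> * ln \<rho>\<close>.\<close>
    case True
    let ?n = "1 - r * neg_part (\<Lambda> w (i + 1)) - r * pos_part (\<Lambda> w i)"
    let ?p = "r * pos_part (\<Lambda> w (i + 1))" and ?m = "r * neg_part (\<Lambda> w i)"
    have "0 \<le> ?n * \<rho> v i" "0 \<le> ?p * \<rho> v (i + 1)" "0 \<le> ?m * \<rho> v (i - 1)"
      using r_pos r_pos_part_le[of w i, OF w_bound] r_pos_part_le[of w "i + 1", OF w_bound]
      by (auto simp: pos_part_nonneg neg_part_nonneg intro!: mult_nonneg_nonneg \<rho>_nonneg)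
    moreover have "?n * \<rho> v i + ?p * \<rho> v (i + 1) + ?m * \<rho> v (i - 1) = 0"
      using True unfolding \<rho>_step transport_def .
    ultimately have "?n * \<rho> v i = 0" "?p * \<rho> v (i + 1) = 0" "?m * \<rho> v (i - 1) = 0" by linarith+
    then have "transport (\<Lambda> w) (\<lambda>i. \<rho> v i * ln (\<rho> v i)) i = 0"
      unfolding transport_def mult.assoc[symmetric] by (simp only:)
    then show ?thesis using True by simp
  next
    case False
    then have y: "\<rho> w i > 0" using \<rho>_step_nonneg[of i] by linarith
    from transport_tangent[of "\<lambda>x. x * ln x" i "1 + ln (\<rho> w i)", OF xlnx_tangent[OF _ y]]
    show ?thesis by (simp add: algebra_simps)
  qed
  from entropy_step[OF this] show ?thesis
    using mult_nonneg_nonpos[OF less_imp_le[OF r_pos] sum_\<rho>_lam_increment] by linarith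
qed

text \<open>For this entropy \<open>y * G' y - G y\<close> is \<open>y - min y (1 / exp 1)\<close>.
  The part \<open>y\<close> is dissipative, and the remaining part lies between 0 and 1, so it costs
  at most the variation of the velocity.\<close>

lemma entropy_f_step:
  "entropy_vec P N L w \<le> entropy_vec P N L v + dt * S * TV_vec N w"
proof -
  define e :: real where "e = 1 / exp 1"
  have e: "0 < e" "e \<le> 1" by (simp_all add: e_def)
  let ?g = "\<lambda>i. if \<rho> w i \<ge> e then ln (\<rho> w i) + 1 else 0"
  have H: "\<rho> w i * ?g i - entropy_f (\<rho> w i) = \<rho> w i - min (\<rho> w i) e" for i
    by (simp add: entropy_f_def e_def[symmetric] algebra_simps)
  have "entropy_f (\<rho> w i) - r * ((\<rho> w i - min (\<rho> w i) e) * (\<Lambda> w (i + 1) - \<Lambda> w i))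
      \<le> transport (\<Lambda> w) (\<lambda>i. entropy_f (\<rho> v i)) i" for i
    using transport_tangent[of entropy_f i "?g i", OF entropy_f_tangent[OF _ \<rho>_step_nonneg, folded e_def]]
    unfolding H by simp
  from entropy_step[OF this]
  have "(\<Sum>i\<in>I. entropy_f (\<rho> w i)) \<le> (\<Sum>i\<in>I. entropy_f (\<rho> v i))
      + r * (\<Sum>i\<in>I. (\<rho> w i - min (\<rho> w i) e) * (\<Lambda> w (i + 1) - \<Lambda> w i))" .
  also have "(\<Sum>i\<in>I. (\<rho> w i - min (\<rho> w i) e) * (\<Lambda> w (i + 1) - \<Lambda> w i))
      \<le> (\<Sum>i\<in>I. \<rho> w i * (\<Lambda> w (i + 1) - \<Lambda> w i) + \<bar>\<Lambda> w (i + 1) - \<Lambda> w i\<bar>)"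
  proof (rule sum_mono)
    fix i
    have "\<bar>min (\<rho> w i) e * (\<Lambda> w (i + 1) - \<Lambda> w i)\<bar> \<le> 1 * \<bar>\<Lambda> w (i + 1) - \<Lambda> w i\<bar>"
      unfolding abs_mult using e \<rho>_step_nonneg[of i] by (intro mult_right_mono) auto
    then show "(\<rho> w i - min (\<rho> w i) e) * (\<Lambda> w (i + 1) - \<Lambda> w i)
        \<le> \<rho> w i * (\<Lambda> w (i + 1) - \<Lambda> w i) + \<bar>\<Lambda> w (i + 1) - \<Lambda> w i\<bar>"
      unfolding left_diff_distrib[of "\<rho> w i"] using abs_ge_minus_self order_trans by fastforce
  qed
  also have "\<dots> \<le> S * TV_vec N w"
    using sum_\<rho>_lam_increment sum_abs_lam_increment by (simp only: sum.distrib)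
  finally have "(\<Sum>i\<in>I. entropy_f (\<rho> w i)) \<le> (\<Sum>i\<in>I. entropy_f (\<rho> v i)) + r * (S * TV_vec N w)"
    using r_pos by simp
  then have "mesh P N * (\<Sum>i\<in>I. entropy_f (\<rho> w i)) \<le> mesh P N * ((\<Sum>i\<in>I. entropy_f (\<rho> v i)) + r * (S * TV_vec N w))"
    using mesh_pos by (intro mult_left_mono) auto
  also have "\<dots> = mesh P N * (\<Sum>i\<in>I. entropy_f (\<rho> v i)) + dt * S * TV_vec N w"
    by (simp add: distrib_left mesh_r mult.assoc)
  finally show ?thesis by (simp add: entropy_vec_def sum_distrib_left)
qed

end

section \<open>The discrete solution and its bounds\<close>

context scheme
begin

lemma solution_exists:
  assumes v: "per_vec N v" "\<And>i. \<bar>v i\<bar> \<le> B" "\<And>i. 0 \<le> \<rho> v i" and B: "B * growth ^ n0 \<le> A"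
  shows "\<exists>u. u 0 = v \<and> (\<forall>n<n0. scheme_solution P K M N L dt S A (u n) (u (Suc n)) \<and> (\<forall>i. \<bar>u n i\<bar> \<le> A))"
proof -
  have B0: "0 \<le> B" using v(2) abs_ge_zero order_trans by blast
  have mono: "B * growth ^ n \<le> A" if "n \<le> n0" for n
    using mult_left_mono[OF power_increasing[OF that growth_ge_1] B0] B by linarith
  \<comment> \<open>The bound \<open>B * growth ^ n\<close> is carried along and stays below
    \<open>A\<close> up to \<open>n0\<close>. Later terms of the sequence are arbitrary, hence the
    guards.\<close>
  let ?P = "\<lambda>n w. (n = 0 \<longrightarrow> w = v) \<and> (n \<le> n0 \<longrightarrow> per_vec N w \<and> (\<forall>i. \<bar>w i\<bar> \<le> B * growth ^ n) \<and> (\<forall>i. 0 \<le> \<rho> w i))"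
  let ?Q = "\<lambda>n v w. n < n0 \<longrightarrow> scheme_solution P K M N L dt S A v w"
  have "\<exists>u. \<forall>n. ?P n (u n) \<and> ?Q n (u n) (u (Suc n))"
  proof (rule dependent_nat_choice)
    show "\<exists>w. ?P 0 w" using v by auto
    fix x n
    assume x: "?P n x"
    show "\<exists>y. ?P (Suc n) y \<and> ?Q n x y"
    proof (cases "n < n0")
      case True
      then have bound: "B * growth ^ n * growth \<le> A" using mono[of "Suc n"] by (simp add: mult_ac)
      from True x have x': "per_vec N x" "\<And>i. \<bar>x i\<bar> \<le> B * growth ^ n" "\<And>i. 0 \<le> \<rho> x i" by auto
      from step_exists[OF x'(1,2) bound] obtain w where w: "per_vec N w"
        "\<And>i. \<bar>w i\<bar> \<le> B * growth ^ n * growth" "update x w = w" by blast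
      interpret sol: scheme_solution P K M N L dt S A x w
        by unfold_locales (use x' w bound order_trans in blast)+
      have "?P (Suc n) w \<and> ?Q n x w"
        using w sol.\<rho>_step_nonneg sol.scheme_solution_axioms by (simp add: mult_ac)
      then show ?thesis by blast
    qed auto
  qed
  then obtain u where u: "\<And>n. ?P n (u n) \<and> ?Q n (u n) (u (Suc n))" by blast
  have "\<bar>u n i\<bar> \<le> A" if "n < n0" for n i
    using u[of n] mono[of n] that by (auto intro: order_trans)
  then show ?thesis using u by (intro exI[of _ u]) auto
qed

lemma growth_power: "growth ^ n = exp (5 / 2 * (real n * dt * (L * S)))"
  by (simp add: growth_def exp_of_nat_mult[symmetric] mult_ac)

lemma admissible_step_iff:
  "admissible_step P K M N L dt A v w \<longleftrightarrow>
     per_vec N w \<and> update v w = w \<and> (\<forall>i. \<bar>w i\<bar> \<le> A) \<and> (\<forall>i. 0 \<le> \<rho> w i)"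
proof -
  have "(MAX i\<in>I. \<bar>w i\<bar>) \<le> A \<longleftrightarrow> (\<forall>i. \<bar>w i\<bar> \<le> A)" if "per_vec N w"
  proof -
    have "(MAX i\<in>I. \<bar>w i\<bar>) \<le> A \<longleftrightarrow> (\<forall>i\<in>I. \<bar>w i\<bar> \<le> A)"
      using N_pos by (subst Max_le_iff) auto
    then show ?thesis
      using per_vec_bound[OF that N_pos, of "\<lambda>x. \<bar>x\<bar> \<le> A"] by blast
  qed
  then show ?thesis unfolding admissible_step_def scheme_step_iff by blast
qed

end

context scheme_solution
begin

lemma admissible: "admissible_step P K M N L dt A v w"
  unfolding admissible_step_iff using w_per w_bound w_eq \<rho>_step_nonneg by blast

lemma admissible_unique:
  assumes "\<And>i. \<bar>v i\<bar> \<le> A"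
  shows "\<exists>!w. admissible_step P K M N L dt A v w"
proof (rule ex1I)
  show "admissible_step P K M N L dt A v w" by (rule admissible)
  fix w' assume "admissible_step P K M N L dt A v w'"
  then show "w' = w"
    unfolding admissible_step_iff using step_unique[of v w' w, OF assms] w_bound w_eq by blast
qed

end

section \<open>The kernel bounds in terms of the scheme\<close>

lemma sum_int_eq_sum_nat: "(\<Sum>i\<in>{0..<2 * int N}. h i) = (\<Sum>j<2 * N. h (int j))"
  by (rule sum.reindex_bij_witness[of _ int nat]) auto

lemma sum_per_vec_reflect:
  assumes "per_vec N v"
  shows "(\<Sum>j\<in>{0..<2 * int N}. v (i - j)) = (\<Sum>j\<in>{0..<2 * int N}. v j)"
proof (cases "N = 0")
  case False
  then show ?thesis
    by (intro sum.reindex_bij_witness[where j = "\<lambda>j. (i - j) mod (2 * int N)" and i = "\<lambda>j. (i - j) mod (2 * int N)"])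
      (auto simp: per_vec_mod[OF assms] mod_simps)
qed simp

text \<open>Reflecting the summation index over a period gives \<open>lam\<close> the matrix entries
  \<open>sigma_PM\<close> at \<open>x i - x j\<close>, as \<open>sigma_PM_negative_type\<close>
  expects; the reflection relies on the period \<open>2 * P\<close> being \<open>2 * N\<close> mesh
  widths.\<close>

lemma (in real_kernel) scheme_kernel:
  assumes "0 < M" "M \<le> N" "(LINT x|lborel. K x) = 0" "\<And>\<xi>. \<xi> \<noteq> 0 \<Longrightarrow> Re (fourier K \<xi>) \<le> 0"
  shows "(\<Sum>j\<in>{0..<2 * int N}. mesh P N * \<bar>sigma_PM P K M (of_int j * mesh P N)\<bar>) \<le> 4 * L1_norm K"
    and "per_vec N v \<Longrightarrow> (\<Sum>i\<in>{0..<2 * int N}. v i * lam P K M N v i) \<le> 0"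
proof -
  show "(\<Sum>j\<in>{0..<2 * int N}. mesh P N * \<bar>sigma_PM P K M (of_int j * mesh P N)\<bar>) \<le> 4 * L1_norm K"
    unfolding sum_int_eq_sum_nat using sum_abs_sigma_PM[OF assms(1,2)] by simp
  assume v: "per_vec N v"
  let ?I = "{0..<2 * int N}"
  let ?x = "\<lambda>i. of_int i * mesh P N"
  have N: "N > 0" using assms by simp
  have "lam P K M N v i = (\<Sum>j\<in>?I. mesh P N * sigma_PM P K M (?x i - ?x j) * v j)" for i
  proof -
    have "sigma_PM P K M (?x (j + 2 * int N)) = sigma_PM P K M (?x j)" for j
      using sigma_PM_periodic[of M "?x j" 1] N by (simp add: mesh_def algebra_simps)
    moreover have "v (i - (j + 2 * int N)) = v (i - j)" for j
      using per_vec_add_mult[OF v, of "i - j" "- 1"] by (simp add: algebra_simps)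
    ultimately have "per_vec N (\<lambda>j. mesh P N * sigma_PM P K M (?x j) * v (i - j))"
      unfolding per_vec_def by simp
    from sum_per_vec_reflect[OF this, of i] show ?thesis
      by (simp add: lam_def left_diff_distrib)
  qed
  then have "(\<Sum>i\<in>?I. v i * lam P K M N v i)
     = mesh P N * (\<Sum>i\<in>?I. \<Sum>j\<in>?I. v i * v j * sigma_PM P K M (?x i - ?x j))"
    by (simp add: sum_distrib_left mult_ac)
  also have "\<dots> \<le> 0"
    using P_pos by (intro mult_nonneg_nonpos sigma_PM_negative_type assms) (auto simp: mesh_def)
  finally show "(\<Sum>i\<in>?I. v i * lam P K M N v i) \<le> 0" .
qed

section \<open>The initial data on the grid\<close>

lemma abs_le_Linf_norm:
  assumes u: "continuous_on UNIV u" "in_Linf {a..b} u" and ab: "a < b" and x: "x \<in> {a..b}"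
  shows "\<bar>u x\<bar> \<le> Linf_norm {a..b} u"
proof -
  let ?E = "Linf_esssup {a..b} u"
  let ?C = "{x. ereal \<bar>u x\<bar> \<le> ?E}"
  have cont: "continuous_on UNIV (\<lambda>x. ereal \<bar>u x\<bar>)"
    using u(1) by (intro continuous_intros)
  \<comment> \<open>By continuity the set where the essential bound holds is closed; being of full
    measure in the open interval, it contains that interval and its closure. Thus the bound applies
    to point values.\<close>
  have closed: "closed ?C"
    using closed_Collect_le[OF cont continuous_on_const] .
  have "AE x in restrict_space lborel {a..b}. x \<in> ?C"
    unfolding Linf_esssup_def mem_Collect_eq by (rule esssup_AE)
  then have "AE x in lborel. x \<in> {a<..<b} \<longrightarrow> x \<in> ?C"
    by (subst (asm) AE_restrict_space_iff) auto
  then have AE: "AE x\<in>{a<..<b} in lebesgue. x \<in> ?C"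
    by (rule AE_completion)
  have "{a<..<b} \<subseteq> ?C"
    by (rule subsetI, rule mem_closed_if_AE_lebesgue_open[OF open_greaterThanLessThan closed AE])
  then have "closure {a<..<b} \<subseteq> ?C" using closed by (rule closure_minimal)
  then have "x \<in> ?C" using x ab by (subst (asm) closure_greaterThanLessThan) blast+
  then have le: "ereal \<bar>u x\<bar> \<le> ?E" by (rule CollectD)
  moreover have "?E < \<infinity>" using u(2) by (simp add: in_Linf_def)
  ultimately show ?thesis
    unfolding Linf_norm_def by (cases "?E") auto
qed

lemma mono_on_closed_interval:
  fixes g :: "real \<Rightarrow> real"
  assumes cont: "continuous_on UNIV g" and mono: "mono_on {a..<b} g"
    and xy: "a \<le> x" "x \<le> y" "y \<le> b"
  shows "g x \<le> g y"
proof (cases "x = y")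
  case False
  have "g x \<le> g z" if "z \<in> {x..<b}" for z
    using mono_onD[OF mono, of x z] that xy by auto
  moreover have "closure {x..<b} = {x..b}" using False xy by (intro closure_atLeastLessThan) auto
  ultimately show ?thesis
    using continuous_ge_on_closure[of "{x..<b}" g y "g x"] cont xy by (auto intro: continuous_on_subset)
qed simp

text \<open>A real \<open>Sup\<close> is informative only for bounded sets. Monotonicity of
  \<open>u x + L * x\<close> bounds \<open>|u y - u x|\<close> by the increment of
  \<open>u x + 2 * L * x\<close> for \<open>x \<le> y\<close>, and these increments
  telescope.\<close>

lemma sum_increments_le_total_variation:
  assumes mono: "\<And>x y. a \<le> x \<Longrightarrow> x \<le> y \<Longrightarrow> y \<le> b \<Longrightarrow> u x + L * x \<le> u y + L * y"
    and L: "0 \<le> L" and s: "\<forall>k\<le>n. s k \<in> {a..b}" "\<forall>k<n. s k \<le> s (Suc k)"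
  shows "(\<Sum>k<n. \<bar>u (s (Suc k)) - u (s k)\<bar>) \<le> total_variation a b u"
  unfolding total_variation_def
proof (rule cSup_upper)
  show "bdd_above {(\<Sum>k<n. \<bar>u (s (Suc k)) - u (s k)\<bar>) | n s.
            (\<forall>k\<le>n. s k \<in> {a..b}) \<and> (\<forall>k<n. s k \<le> s (Suc k))}"
  proof (rule bdd_aboveI)
    fix t assume "t \<in> {(\<Sum>k<n. \<bar>u (s (Suc k)) - u (s k)\<bar>) | n s.
            (\<forall>k\<le>n. s k \<in> {a..b}) \<and> (\<forall>k<n. s k \<le> s (Suc k))}"
    then obtain n s where s: "\<And>k. k \<le> n \<Longrightarrow> s k \<in> {a..b}" "\<And>k. k < n \<Longrightarrow> s k \<le> s (Suc k)"
      and t: "t = (\<Sum>k<n. \<bar>u (s (Suc k)) - u (s k)\<bar>)" by blast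
    let ?g = "\<lambda>k. u (s k) + 2 * L * s k"
    have "t \<le> (\<Sum>k<n. ?g (Suc k) - ?g k)"
      unfolding t
    proof (rule sum_mono)
      fix k assume "k \<in> {..<n}"
      then have k: "a \<le> s k" "s k \<le> s (Suc k)" "s (Suc k) \<le> b" using s(1)[of k] s(1)[of "Suc k"] s(2)[of k] by auto
      have "L * s k \<le> L * s (Suc k)" using k L by (intro mult_left_mono)
      then show "\<bar>u (s (Suc k)) - u (s k)\<bar> \<le> ?g (Suc k) - ?g k"
        using mono[OF k] by (simp add: abs_le_iff)
    qed
    also have "\<dots> = (u (s n) + L * s n) - (u (s 0) + L * s 0) + (L * s n - L * s 0)"
      unfolding sum_lessThan_telescope[of ?g] by (simp add: algebra_simps)
    also have "\<dots> \<le> (u b + L * b) - (u a + L * a) + (L * b - L * a)"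
    proof -
      have "a \<le> s n" "s n \<le> b" "a \<le> s 0" "s 0 \<le> b" using s(1)[of n] s(1)[of 0] by auto
      then show ?thesis
        using mono[of "s n" b] mono[of a "s 0"]
          mult_left_mono[OF _ L, of "s n" b] mult_left_mono[OF _ L, of a "s 0"] by linarith
    qed
    finally show "t \<le> (u b + L * b) - (u a + L * a) + (L * b - L * a)" .
  qed
qed (use s in blast)

text \<open>If \<open>L * \<kappa>\<close> respectively \<open>\<kappa> * A\<close> is 0, so is the
  left side; otherwise the extended quotients are ordinary numbers. The entry \<open>1\<close> of
  the first minimum yields \<open>4 / 10\<close>, the entry \<open>1 / (3 * A)\<close> of the second
  \<open>4 / 30\<close>.\<close>

lemma step_size_condD:
  assumes "step_size_cond L \<kappa> A dt dx" "0 \<le> L" "0 \<le> \<kappa>" "0 \<le> A" "0 < dt" "0 < dx"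
  shows "dt * (L * (4 * \<kappa>)) \<le> 2 / 5" "dt / dx * (4 * \<kappa> * A) \<le> 2 / 15"
proof -
  have 1: "ereal dt < 1 / ereal (10 * L * \<kappa>) * min (1 / ereal (A + 1)) 1"
    and 2: "ereal (dt / dx) < 1 / ereal (10 * \<kappa>) * min (1 / ereal (A + 1)) (1 / ereal (3 * A))"
    using assms(1) by (simp_all add: step_size_cond_def)
  show "dt * (L * (4 * \<kappa>)) \<le> 2 / 5"
  proof (cases "L * \<kappa> = 0")
    case False
    then have pos: "L * \<kappa> > 0" using assms by simp
    have eq: "1 / ereal (10 * L * \<kappa>) = ereal (1 / (10 * (L * \<kappa>)))"
      using False by (simp add: one_ereal_def mult.assoc)
    have "1 / ereal (10 * L * \<kappa>) * min (1 / ereal (A + 1)) 1 \<le> 1 / ereal (10 * L * \<kappa>) * 1"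
      unfolding eq using pos by (intro ereal_mult_left_mono) auto
    then have "ereal dt < ereal (1 / (10 * (L * \<kappa>)))"
      using 1 unfolding eq by (simp only: mult_1_right order_less_le_trans)
    then have "dt < 1 / (10 * (L * \<kappa>))" by simp
    then show ?thesis using pos by (simp add: field_simps)
  qed auto
  show "dt / dx * (4 * \<kappa> * A) \<le> 2 / 15"
  proof (cases "\<kappa> * A = 0")
    case False
    then have pos: "\<kappa> > 0" "A > 0" using assms by auto
    have eq: "1 / ereal (10 * \<kappa>) = ereal (1 / (10 * \<kappa>))" "1 / ereal (3 * A) = ereal (1 / (3 * A))"
      using pos by (simp_all add: one_ereal_def)
    have "1 / ereal (10 * \<kappa>) * min (1 / ereal (A + 1)) (1 / ereal (3 * A)) \<le> 1 / ereal (10 * \<kappa>) * (1 / ereal (3 * A))"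
      unfolding eq using pos by (intro ereal_mult_left_mono) auto
    then have "ereal (dt / dx) < ereal (1 / (10 * \<kappa>)) * ereal (1 / (3 * A))"
      using 2 unfolding eq by (rule order_less_le_trans[rotated])
    then have "dt / dx < 1 / (10 * \<kappa>) * (1 / (3 * A))" by (simp only: times_ereal.simps less_ereal.simps)
    then have "dt / dx * (30 * (\<kappa> * A)) < 1 / (10 * \<kappa>) * (1 / (3 * A)) * (30 * (\<kappa> * A))"
      using pos by (intro mult_strict_right_mono) auto
    also have "\<dots> = 1" using pos by simp
    finally have "4 * (dt / dx * (\<kappa> * A)) \<le> 2 / 15" by linarith
    then show ?thesis by (simp only: mult_ac)
  qed auto
qed

lemma initial_data_mono:
  assumes "initial_data P L u0" "- P \<le> x" "x \<le> y" "y \<le> P"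
  shows "u0 x + L * x \<le> u0 y + L * y"
proof (rule mono_on_closed_interval[where g = "\<lambda>x. u0 x + L * x"])
  show "continuous_on UNIV (\<lambda>x. u0 x + L * x)"
    using assms(1) unfolding initial_data_def by (intro continuous_on_add continuous_on_mult_left continuous_on_id) blast
  show "mono_on {-P..<P} (\<lambda>x. u0 x + L * x)"
    using assms(1) by (simp add: initial_data_def)
qed fact+

context
  fixes P L :: real and u0 :: "real \<Rightarrow> real" and N :: nat and v :: "int \<Rightarrow> real"
  assumes P: "P > 0" and N: "N > 0" and L: "0 \<le> L" and init: "initial_data P L u0"
  defines "v \<equiv> \<lambda>i. u0 (of_int i * mesh P N)"
begin

lemma grid_per: "per_vec N v"
proof -
  have "per P u0" using init by (simp add: initial_data_def)
  then have "u0 (of_int i * mesh P N + 2 * P) = u0 (of_int i * mesh P N)" for i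
    by (simp add: per_def)
  moreover have "of_int (i + 2 * int N) * mesh P N = of_int i * mesh P N + 2 * P" for i
    using N by (simp add: mesh_def algebra_simps)
  ultimately have "v (i + 2 * int N) = v i" for i unfolding v_def by (simp only:)
  then show ?thesis by (simp add: per_vec_def)
qed

text \<open>The shift by \<open>N\<close> places one period of indices on \<open>[-P, P]\<close>,
  where the data are controlled. The form \<open>i + - int N\<close> matches
  \<open>per_vec_shift\<close>.\<close>

lemma grid_point_bounds:
  assumes "i \<in> {0..2 * int N}"
  shows "- P \<le> of_int (i + - int N) * mesh P N" "of_int (i + - int N) * mesh P N \<le> P"
proof -
  have NP: "real N * mesh P N = P" using N by (simp add: mesh_def)
  have m: "0 \<le> mesh P N" using P by (simp add: mesh_def)
  have "- real N \<le> of_int (i + - int N)" "of_int (i + - int N) \<le> real N" using assms by auto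
  from this[THEN mult_right_mono, OF m]
  show "- P \<le> of_int (i + - int N) * mesh P N" "of_int (i + - int N) * mesh P N \<le> P"
    using NP by simp_all
qed

lemma grid_abs_le: "\<bar>v i\<bar> \<le> Linf_norm {-P..P} u0"
proof -
  have "\<bar>v (i + int N + - int N)\<bar> \<le> Linf_norm {-P..P} u0"
  proof (rule per_vec_bound[OF per_vec_shift[OF grid_per] N, where Q = "\<lambda>x. \<bar>x\<bar> \<le> Linf_norm {-P..P} u0"])
    fix i assume "i \<in> {0..<2 * int N}"
    then show "\<bar>v (i + - int N)\<bar> \<le> Linf_norm {-P..P} u0"
      unfolding v_def using grid_point_bounds[of i] init P
      by (intro abs_le_Linf_norm) (auto simp: initial_data_def)
  qed
  then show ?thesis by simp
qed

lemma grid_slope_nonneg: "0 \<le> theta P N v i + L"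
proof -
  have "0 \<le> theta P N v (i + int N + - int N) + L"
  proof (rule per_vec_bound[OF per_vec_shift[OF theta_per[OF grid_per]] N, where Q = "\<lambda>x. 0 \<le> x + L"])
    fix i assume i: "i \<in> {0..<2 * int N}"
    have m: "0 < mesh P N" using P N by (simp add: mesh_def)
    let ?x = "of_int (i + - int N) * mesh P N" and ?y = "of_int (i + 1 + - int N) * mesh P N"
    have y: "?y = ?x + mesh P N" by (simp add: algebra_simps)
    have "- P \<le> ?x" "?y \<le> P"
      using i by (intro grid_point_bounds; simp)+
    then have "u0 ?x + L * ?x \<le> u0 ?y + L * ?y"
      using y m by (intro initial_data_mono[OF init]) linarith+
    then have "(u0 ?y - u0 ?x) + L * (?y - ?x) \<ge> 0" by (simp only: right_diff_distrib)
    then have "0 \<le> (u0 ?y - u0 ?x) + L * mesh P N" unfolding y by simp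
    then show "0 \<le> theta P N v (i + - int N) + L"
      using m unfolding theta_def v_def by (simp add: field_simps del: of_int_add of_int_minus)
  qed
  then show ?thesis by simp
qed

lemma grid_TV_le: "TV_vec N v \<le> total_variation (- P) P u0"
proof -
  let ?s = "\<lambda>k. of_int (int k + - int N) * mesh P N"
  have m: "0 < mesh P N" using P N by (simp add: mesh_def)
  have "per_vec N (\<lambda>i. \<bar>v (i + 1) - v i\<bar>)"
    by (rule per_vec_comp2[OF per_vec_shift[OF grid_per] grid_per])
  from sum_per_vec_shift[OF this, of "- int N"]
  have "TV_vec N v = (\<Sum>i\<in>{0..<2 * int N}. \<bar>v (i + - int N + 1) - v (i + - int N)\<bar>)"
    unfolding TV_vec_def by simp
  also have "\<dots> = (\<Sum>k<2 * N. \<bar>u0 (?s (Suc k)) - u0 (?s k)\<bar>)"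
    unfolding sum_int_eq_sum_nat v_def by (intro sum.cong refl) (simp add: algebra_simps)
  also have "\<dots> \<le> total_variation (- P) P u0"
  proof (rule sum_increments_le_total_variation[OF initial_data_mono[OF init] L])
    show "\<forall>k\<le>2 * N. ?s k \<in> {- P..P}"
    proof (intro allI impI)
      fix k assume "k \<le> 2 * N"
      then have "int k \<in> {0..2 * int N}" by simp
      from grid_point_bounds[OF this] show "?s k \<in> {- P..P}" unfolding atLeastAtMost_iff by blast
    qed
    show "\<forall>k<2 * N. ?s k \<le> ?s (Suc k)" using m by (auto intro!: mult_right_mono)
  qed
  finally show ?thesis .
qed

end

section \<open>Assembly of the discrete solution and its bounds\<close>

lemma scheme_bounds:
  assumes T: "T > 0" and K: "kernel_assm K" "L1_norm K = \<kappa>" and P: "P > 0"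
    and MN: "M \<ge> 1" "N \<ge> M" "NT \<ge> 1" and L: "0 \<le> L" and init: "initial_data P L u0"
    and dt: "dt = T / real NT" and A: "A = Linf_norm {-P..P} u0 * exp (10 * L * T * \<kappa>)"
    and step: "step_size_cond L \<kappa> A dt (mesh P N)"
  shows "\<exists>u :: nat \<Rightarrow> int \<Rightarrow> real.
         u 0 = (\<lambda>i. u0 (of_int i * mesh P N)) \<and>
         (\<forall>n<NT. admissible_step P K M N L dt A (u n) (u (Suc n)) \<and>
                 (\<exists>!w. admissible_step P K M N L dt A (u n) w)) \<and>
         (\<forall>n\<in>{1..NT}. TV_vec N (u n) \<le> total_variation (-P) P u0 * exp (10 * L * T * \<kappa>)) \<and>
         (\<forall>n\<in>{1..NT}. entropy_vec P N L (u n)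
            \<le> entropy_vec P N L (u 0) + (1 + 4 * T * \<kappa> * exp (10 * T * \<kappa>)) * total_variation (-P) P u0)"
proof -
  define v where "v = (\<lambda>i. u0 (of_int i * mesh P N))"
  have N: "N > 0" using MN by simp
  have grid: "per_vec N v" "\<bar>v i\<bar> \<le> Linf_norm {-P..P} u0" "0 \<le> theta P N v i + L"
    "TV_vec N v \<le> total_variation (- P) P u0" for i
    unfolding v_def
    by (rule grid_per grid_abs_le grid_slope_nonneg grid_TV_le; rule P N L init)+
  have \<kappa>: "0 \<le> \<kappa>" unfolding K(2)[symmetric] L1_norm_def by (intro integral_nonneg_AE) simp
  have A0: "0 \<le> A" unfolding A using order_trans[OF abs_ge_zero grid(2)] by simp
  have dt0: "0 < dt" "real NT * dt = T" unfolding dt using T MN by auto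
  have mesh0: "0 < mesh P N" using P N by (simp add: mesh_def)
  interpret real_kernel P K
    by unfold_locales (use P K in \<open>auto simp: kernel_assm_def\<close>)
  have K0: "(LINT x|lborel. K x) = 0" "\<And>\<xi>. \<xi> \<noteq> 0 \<Longrightarrow> Re (fourier K \<xi>) \<le> 0"
    using K(1) by (simp_all add: kernel_assm_def)
  interpret scheme P K M N L dt "4 * \<kappa>" A
  proof
    show "(\<Sum>j\<in>{0..<2 * int N}. mesh P N * \<bar>sigma_PM P K M (of_int j * mesh P N)\<bar>) \<le> 4 * \<kappa>"
      unfolding K(2)[symmetric] using MN by (intro scheme_kernel(1) K0) auto
    show "(\<Sum>i\<in>{0..<2 * int N}. v i * lam P K M N v i) \<le> 0" if "per_vec N v" for v
      using MN that by (intro scheme_kernel(2) K0) auto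
  qed (use P N L \<kappa> A0 dt0 step_size_condD[OF step L \<kappa> A0 dt0(1) mesh0] in auto)
  have growth: "growth ^ NT = exp (10 * L * T * \<kappa>)"
    unfolding growth_power dt0(2) by (simp add: mult_ac)
  obtain u where u: "u 0 = v" "\<And>n. n < NT \<Longrightarrow> scheme_solution P K M N L dt (4 * \<kappa>) A (u n) (u (Suc n))"
      "\<And>n i. n < NT \<Longrightarrow> \<bar>u n i\<bar> \<le> A"
    using solution_exists[OF grid(1-3), of NT] by (auto simp: growth A)
  let ?TV = "total_variation (- P) P u0"
  have TV0: "0 \<le> TV_vec N w" for w by (simp add: TV_vec_def sum_nonneg)
  then have TV0': "0 \<le> ?TV" using grid(4) order_trans by blast
  have TV: "TV_vec N (u n) \<le> ?TV * growth ^ n" if "n \<le> NT" for n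
    using that
  proof (induction n)
    case (Suc n)
    then interpret scheme_solution P K M N L dt "4 * \<kappa>" A "u n" "u (Suc n)" using u(2) by simp
    have "TV_vec N (u (Suc n)) \<le> TV_vec N (u n) * growth" by (rule TV_step)
    also have "\<dots> \<le> (?TV * growth ^ n) * growth"
      using Suc growth_ge_1 by (intro mult_right_mono) auto
    finally show ?case by (simp add: mult_ac)
  qed (use u(1) grid(4) in simp)
  have TV': "TV_vec N (u n) \<le> ?TV * exp (10 * L * T * \<kappa>)" if "n \<le> NT" for n
    using TV[OF that] mult_left_mono[OF power_increasing[OF that growth_ge_1] TV0']
    unfolding growth by linarith
  \<comment> \<open>The summand with the exponential serves \<open>L < 1\<close>, where the
    variation is bounded independently of \<open>L\<close> and the errors of all steps add up to a
    multiple of \<open>T\<close>. The summand 1 serves \<open>L \<ge> 1\<close>.\<close>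
  have entropy: "entropy_vec P N L (u n) \<le> entropy_vec P N L (u 0) + (1 + 4 * T * \<kappa> * exp (10 * T * \<kappa>)) * ?TV"
    if "n \<le> NT" for n
  proof (cases "L < 1")
    case True
    have "exp (10 * L * T * \<kappa>) \<le> exp (10 * T * \<kappa>)"
      using True T \<kappa> L mult_right_mono[of L 1 "10 * (T * \<kappa>)"] by (simp add: mult_ac)
    from mult_left_mono[OF this TV0']
    have TV1: "TV_vec N (u n) \<le> ?TV * exp (10 * T * \<kappa>)" if "n \<le> NT" for n
      using TV'[OF that] by linarith
    let ?c = "dt * (4 * \<kappa>) * (?TV * exp (10 * T * \<kappa>))"
    have c0: "0 \<le> ?c" using dt0 \<kappa> TV0' by simp
    have "entropy_vec P N L (u n) \<le> entropy_vec P N L (u 0) + real n * ?c"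
      using that
    proof (induction n)
      case (Suc n)
      then interpret scheme_solution P K M N L dt "4 * \<kappa>" A "u n" "u (Suc n)" using u(2) by simp
      have "entropy_vec P N L (u (Suc n)) \<le> entropy_vec P N L (u n) + dt * (4 * \<kappa>) * TV_vec N (u (Suc n))"
        by (rule entropy_f_step)
      also have "\<dots> \<le> entropy_vec P N L (u n) + ?c"
        using Suc dt0 \<kappa> by (intro add_left_mono mult_left_mono TV1) auto
      finally show ?case using Suc by (simp add: algebra_simps)
    qed simp
    also have "\<dots> \<le> entropy_vec P N L (u 0) + real NT * ?c"
      using that c0 by (intro add_left_mono mult_right_mono) auto
    also have "real NT * ?c = 4 * T * \<kappa> * exp (10 * T * \<kappa>) * ?TV"
      unfolding dt0(2)[symmetric] by (simp add: mult_ac)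
    also have "\<dots> \<le> (1 + 4 * T * \<kappa> * exp (10 * T * \<kappa>)) * ?TV"
      using TV0' by (intro mult_right_mono) auto
    finally show ?thesis by simp
  next
    case False
    have \<rho>: "0 \<le> \<rho> (u n) i" if "n \<le> NT" for n i
    proof (cases n)
      case (Suc m)
      then interpret scheme_solution P K M N L dt "4 * \<kappa>" A "u m" "u (Suc m)" using u(2) that by simp
      show ?thesis using \<rho>_step_nonneg Suc by simp
    qed (use u(1) grid(3) in simp)
    have mono: "(\<Sum>i\<in>I. \<rho> (u n) i * ln (\<rho> (u n) i)) \<le> (\<Sum>i\<in>I. \<rho> (u 0) i * ln (\<rho> (u 0) i))"
      using that
    proof (induction n)
      case (Suc n)
      then interpret scheme_solution P K M N L dt "4 * \<kappa>" A "u n" "u (Suc n)" using u(2) by simp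
      show ?case using xlnx_step Suc by simp
    qed simp
    \<comment> \<open>No error accumulates over time: \<open>entropy_f\<close> is exchanged for
      \<open>x * ln x + 1 / exp 1\<close> at time \<open>n\<close> and back at time 0, and only the
      second exchange costs something, namely the initial variation.\<close>
    have "(\<Sum>i\<in>I. entropy_f (\<rho> (u n) i)) \<le> (\<Sum>i\<in>I. \<rho> (u n) i * ln (\<rho> (u n) i) + 1 / exp 1)"
      using \<rho>[OF that] by (intro sum_mono entropy_f_le_xlnx)
    also have "\<dots> \<le> (\<Sum>i\<in>I. \<rho> (u 0) i * ln (\<rho> (u 0) i) + 1 / exp 1)"
      using mono by (simp only: sum.distrib add_le_cancel_right)
    also have "\<dots> \<le> (\<Sum>i\<in>I. entropy_f (\<rho> (u 0) i) + \<bar>\<rho> (u 0) i - L\<bar>)"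
      using \<rho>[of 0] False by (intro sum_mono xlnx_le_entropy_f) auto
    also have "\<dots> = (\<Sum>i\<in>I. entropy_f (\<rho> (u 0) i)) + (\<Sum>i\<in>I. \<bar>theta P N (u 0) i\<bar>)"
      by (simp add: sum.distrib)
    finally have "mesh P N * (\<Sum>i\<in>I. entropy_f (\<rho> (u n) i))
        \<le> mesh P N * ((\<Sum>i\<in>I. entropy_f (\<rho> (u 0) i)) + (\<Sum>i\<in>I. \<bar>theta P N (u 0) i\<bar>))"
      using mesh0 by (intro mult_left_mono) auto
    then have "entropy_vec P N L (u n) \<le> entropy_vec P N L (u 0) + TV_vec N (u 0)"
      by (simp only: entropy_vec_def TV_vec_eq sum_distrib_left distrib_left)
    also have "TV_vec N (u 0) \<le> 1 * ?TV" using u(1) grid(4) by simp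
    also have "\<dots> \<le> (1 + 4 * T * \<kappa> * exp (10 * T * \<kappa>)) * ?TV"
      using T \<kappa> TV0' by (intro mult_right_mono) auto
    finally show ?thesis by simp
  qed
  show ?thesis
  proof (intro exI[of _ u] conjI allI ballI impI)
    fix n assume n: "n < NT"
    interpret scheme_solution P K M N L dt "4 * \<kappa>" A "u n" "u (Suc n)" using u(2) n by simp
    show "admissible_step P K M N L dt A (u n) (u (Suc n))" by (rule admissible)
    show "\<exists>!w. admissible_step P K M N L dt A (u n) w" using u(3)[OF n] by (rule admissible_unique)
  qed (use u(1) TV' entropy in \<open>auto simp: v_def\<close>)
qed

theorem theorem1:
  fixes T \<kappa> :: real
  assumes "T > 0"
  shows "\<exists>\<zeta>0 > 0. \<forall>(K :: real \<Rightarrow> real) (v0 :: real \<Rightarrow> real) (u0 :: real \<Rightarrow> real)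
            (P :: real) (M :: nat) (N :: nat) (NT :: nat).
    (let L = mean_slope v0 P; dt = T / real NT;
         A = Linf_norm {-P..P} u0 * exp (10 * L * T * \<kappa>)
     in
      kernel_assm K \<and> L1_norm K = \<kappa> \<and>
      P > 0 \<and> M \<ge> 1 \<and> N \<ge> M \<and> NT \<ge> 1 \<and>
      v0_assm v0 \<and> initial_data P L u0 \<and>
      step_size_cond L \<kappa> A dt (mesh P N)
      \<longrightarrow>
      (\<exists>u :: nat \<Rightarrow> int \<Rightarrow> real.
         u 0 = (\<lambda>i. u0 (of_int i * mesh P N)) \<and>
         (\<forall>n<NT. admissible_step P K M N L dt A (u n) (u (Suc n)) \<and>
                 (\<exists>!w. admissible_step P K M N L dt A (u n) w)) \<and>
         (\<forall>n\<in>{1..NT}. TV_vec N (u n) \<le> total_variation (-P) P u0 * exp (10 * L * T * \<kappa>)) \<and>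
         (\<forall>n\<in>{1..NT}. entropy_vec P N L (u n)
                          \<le> entropy_vec P N L (u 0) + \<zeta>0 * total_variation (-P) P u0)))"
proof -
  \<comment> \<open>The constant is fixed before \<open>\<kappa>\<close> is known to be a norm; the
    absolute values make it positive for every real \<open>\<kappa>\<close>.\<close>
  define \<zeta> where "\<zeta> = 1 + 4 * T * \<bar>\<kappa>\<bar> * exp (10 * T * \<bar>\<kappa>\<bar>)"
  have "\<zeta> > 0" using assms by (simp add: \<zeta>_def add_pos_nonneg)
  then show ?thesis
  proof (intro exI[of _ \<zeta>] conjI allI, assumption, unfold Let_def, intro impI, elim conjE)
    fix K v0 u0 :: "real \<Rightarrow> real" and P :: real and M N NT :: nat
    assume a: "kernel_assm K" "L1_norm K = \<kappa>" "P > 0" "M \<ge> 1" "N \<ge> M" "NT \<ge> 1" "v0_assm v0"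
      "initial_data P (mean_slope v0 P) u0"
      "step_size_cond (mean_slope v0 P) \<kappa> (Linf_norm {-P..P} u0 * exp (10 * mean_slope v0 P * T * \<kappa>))
         (T / real NT) (mesh P N)"
    have "mono v0" using a(7) by (simp add: v0_assm_def)
    then have L: "0 \<le> mean_slope v0 P"
      using a(3) monoD[of v0 "- P" P] by (simp add: mean_slope_def)
    have "0 \<le> \<kappa>" unfolding a(2)[symmetric] L1_norm_def by (intro integral_nonneg_AE) simp
    then have \<zeta>: "\<zeta> = 1 + 4 * T * \<kappa> * exp (10 * T * \<kappa>)" by (simp add: \<zeta>_def)
    note bounds = scheme_bounds[OF assms a(1-6) L a(8) refl refl a(9)]
    show "\<exists>u :: nat \<Rightarrow> int \<Rightarrow> real.
         u 0 = (\<lambda>i. u0 (of_int i * mesh P N)) \<and>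
         (\<forall>n<NT. admissible_step P K M N (mean_slope v0 P) (T / real NT)
                   (Linf_norm {-P..P} u0 * exp (10 * mean_slope v0 P * T * \<kappa>)) (u n) (u (Suc n)) \<and>
                 (\<exists>!w. admissible_step P K M N (mean_slope v0 P) (T / real NT)
                   (Linf_norm {-P..P} u0 * exp (10 * mean_slope v0 P * T * \<kappa>)) (u n) w)) \<and>
         (\<forall>n\<in>{1..NT}. TV_vec N (u n) \<le> total_variation (-P) P u0 * exp (10 * mean_slope v0 P * T * \<kappa>)) \<and>
         (\<forall>n\<in>{1..NT}. entropy_vec P N (mean_slope v0 P) (u n)
            \<le> entropy_vec P N (mean_slope v0 P) (u 0) + \<zeta> * total_variation (-P) P u0)"
      unfolding \<zeta> by (rule bounds)
  qed
qed

end
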